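(* Consider the Bayesian game defined by the payoff $u_{i,h}^\Gamma$ for $\Gamma\in\{S,U,W\}$, and let the information $I_{i,h}^\Omega$ of consumer $i$ at slot $h$ of the time zone $\mathcal{T}$ be defined by the information exchange model $\Omega\in\{P,AS,B\}$. Write $\tilde{\mathbf{g}}=[\mathbf{g}^T,\bar g]^T\in\mathbb{R}^{N+1}$. Given the normal prior on the preference profile $\mathbf{g}$, consumer $i$'s mean estimate of the preference profile at each $h\in\mathcal{T}$ can be written as a linear combination of $\tilde{\mathbf{g}}$, that is, $$E[\tilde{\mathbf{g}}\mid I_{i,h}^\Omega]=\mathbf{T}_{i,h}^\Omega\tilde{\mathbf{g}}\quad\text{with } \mathbf{T}_{i,h}^\Omega\in\mathbb{R}^{(N+1)\times(N+1)}\text{ for all }h\in\mathcal{T},$$ and the unique equilibrium (Bayesian Nash) strategy of $i$ is linear in its estimate of the augmented preference profile: $$s_{i,h}^\Gamma(I_{i,h}^\Omega)=\mathbf{v}_{i,h}^TE[\tilde{\mathbf{g}}\mid I_{i,h}^\Omega]+r_{i,h},$$ where $\mathbf{v}_{i,h}\in\mathbb{R}^{N+1}$ and $r_{i,h}\in\mathbb{R}$ are the strategy coefficients. The strategy coefficients are calculated by solving the following sets of equations: $$\mathbf{T}_{i,h}^{\Omega T}\mathbf{v}_{i,h}+\rho_h^\Gamma\lambda_h^\Gamma\sum_{j\neq i}\mathbf{T}_{i,h}^{\Omega T}\mathbf{T}_{j,h}^{\Omega T}\mathbf{v}_{j,h}=\rho_h^\Gamma\mathbf{e}_i\qquad\text{for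 all } i\in\{1,\dots,N\},$$ $$r_{i,h}+\rho_h^\Gamma\lambda_h^\Gamma\sum_{j\neq i}r_{j,h}=-\rho_h^\Gamma\mu_h^\Gamma\bar\omega_h\qquad\text{for all } i\in\{1,\dots,N\},$$ where $\rho_h^\Gamma=(2(\tau_h^\Gamma+\alpha_h))^{-1}$ and $\mathbf{e}_i\in\mathbb{R}^{N+1}$ is the $i$-th unit vector.
   Context: There are $N$ consumers. The time zone $\mathcal{T}$ is a run of consecutive slots, numbered from $1$, during which the preference profile does not change. The preference vector $\mathbf{g}=(g_1,\dots,g_N)^T$ has a normal probability density with mean $\bar g\mathbf{1}$, $\bar g>0$, and covariance matrix $\Sigma$. For each $h$, constants $\gamma_h,\alpha_h,\kappa_h>0$ are given and $\omega_h$ is a real random variable with mean $\bar\omega_h$, independent of $\mathbf{g}$. Consumer $i$ consumes $l_{i,h}$; $L_h=\sum_i l_{i,h}$. Payoffs: $u_{i,h}=-l_{i,h}\frac{\gamma_h}{N}(L_h+\omega_h)+g_il_{i,h}-\alpha_hl_{i,h}^2$; $U_h=\sum_iu_{i,h}$; $W_h=U_h+\frac{\gamma_h}{N}(L_h+\omega_h)L_h-\frac{\kappa_h}{N}L_h^2$. Put $u_{i,h}^S=u_{i,h}$ (selfish), $u_{i,h}^U=U_h$ (altruistic), $u_{i,h}^W=W_h$ (welfare-maximizing). Constants: $\lambda_h^S=\mu_h^S=\tau_h^S=\gamma_h/N$; $\lambda_h^U=2\gamma_h/N$, $\mu_h^U=\tau_h^U=\gamma_h/N$; $\lambda_h^W=2\kappa_h/N$,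 $\mu_h^W=0$, $\tau_h^W=\kappa_h/N$. Information of consumer $i$ at slot $h$: private, $I_{i,h}^P=\{g_i\}$; action-sharing, given a graph on $\{1,\dots,N\}$ known to all and with $\mathcal{N}_i$ the neighbors of $i$, $I_{i,h}^{AS}=\{g_i,\ (l_{j,t})_{j\in\mathcal{N}_i,\,1\le t\le h-1}\}$; broadcast, $I_{i,h}^B=\{g_i,L_1,\dots,L_{h-1}\}$. The past consumptions are those realized from the equilibrium strategies, $l_{j,t}=s_{j,t}^\Gamma(I_{j,t}^\Omega)$. A strategy of consumer $i$ at slot $h$ is a map $s_{i,h}$ from its possible information $I_{i,h}^\Omega$ to $\mathbb{R}^+$. A Bayesian Nash equilibrium strategy is a profile $\{s_{i,h}^\Gamma\}_{i,\,h\in\mathcal{T}}$ such that for all $i$, all $h\in\mathcal{T}$, all information $I_{i,h}^\Omega$, and any strategy $s_{i,h}$ mapping $I_{i,h}^\Omega$ to $\mathbb{R}^+$, $$E[u_{i,h}^\Gamma(s_{i,h}^\Gamma,\mathbf{s}_{-i,h}^\Gamma)\mid I_{i,h}^\Omega]\ge E[u_{i,h}^\Gamma(s_{i,h},\mathbf{s}_{-i,h}^\Gamma)\mid I_{i,h}^\Omega].$$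
   Formalization: Strategies and deviations map to all of R, not R^+ (with R^+ the claim fails: the linear strategy of some consumer is negative with positive probability); they are Borel with square-integrable consumption, and optimality and uniqueness hold almost surely. *)

theory Defs
  imports "HOL-Probability.Probability"
begin

text \<open>
  Consumers are the elements of a finite type, so that N is its cardinality.  Preference profiles
  are vectors over that type; augmented profiles are vectors over its option type, with
  \<^const>\<open>None\<close> in the role of coordinate N + 1.
\<close>

definition mvnormal_density :: "real^'n::finite \<Rightarrow> real^'n^'n \<Rightarrow> real^'n \<Rightarrow> real" where
  "mvnormal_density m \<Sigma> x =
     exp (- ((x - m) \<bullet> (matrix_inv \<Sigma> *v (x - m))) / 2) / sqrt ((2 * pi) ^ CARD('n) * det \<Sigma>)"

definition pos_def_matrix :: "real^'n^'n::finite \<Rightarrow> bool" where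
  "pos_def_matrix \<Sigma> \<longleftrightarrow> transpose \<Sigma> = \<Sigma> \<and> (\<forall>x. x \<noteq> 0 \<longrightarrow> 0 < x \<bullet> (\<Sigma> *v x))"

definition augment :: "real \<Rightarrow> real^'n::finite \<Rightarrow> real^('n option)" where
  "augment gbar y = (\<chi> k. case k of Some i \<Rightarrow> y $ i | None \<Rightarrow> gbar)"


subsection \<open>Payoffs\<close>

datatype behavior = Selfish | Altruistic | Welfare

context
  fixes \<gamma> \<alpha> \<kappa> :: real
begin

definition own_payoff :: "real^'n \<Rightarrow> 'n::finite \<Rightarrow> ('n \<Rightarrow> real) \<Rightarrow> real \<Rightarrow> real" where
  "own_payoff y i l w =
     - l i * (\<gamma> / real CARD('n)) * ((\<Sum>j\<in>UNIV. l j) + w) + y $ i * l i - \<alpha> * (l i)\<^sup>2"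

definition total_payoff :: "real^'n \<Rightarrow> ('n::finite \<Rightarrow> real) \<Rightarrow> real \<Rightarrow> real" where
  "total_payoff y l w = (\<Sum>i\<in>UNIV. own_payoff y i l w)"

definition welfare :: "real^'n \<Rightarrow> ('n::finite \<Rightarrow> real) \<Rightarrow> real \<Rightarrow> real" where
  "welfare y l w =
     (let L = (\<Sum>j\<in>UNIV. l j) in
      total_payoff y l w + \<gamma> / real CARD('n) * (L + w) * L - \<kappa> / real CARD('n) * L\<^sup>2)"

fun payoff :: "behavior \<Rightarrow> real^'n \<Rightarrow> 'n::finite \<Rightarrow> ('n \<Rightarrow> real) \<Rightarrow> real \<Rightarrow> real" where
  "payoff Selfish y i l w = own_payoff y i l w"
| "payoff Altruistic y i l w = total_payoff y l w"
| "payoff Welfare y i l w = welfare y l w"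

end

text \<open>In the following constants the parameters are N, \<gamma>, \<kappa> (and \<alpha> for the last one).\<close>

fun coeff_lambda :: "behavior \<Rightarrow> real \<Rightarrow> real \<Rightarrow> real \<Rightarrow> real" where
  "coeff_lambda Selfish N \<gamma> \<kappa> = \<gamma> / N"
| "coeff_lambda Altruistic N \<gamma> \<kappa> = 2 * \<gamma> / N"
| "coeff_lambda Welfare N \<gamma> \<kappa> = 2 * \<kappa> / N"

fun coeff_mu :: "behavior \<Rightarrow> real \<Rightarrow> real \<Rightarrow> real \<Rightarrow> real" where
  "coeff_mu Selfish N \<gamma> \<kappa> = \<gamma> / N"
| "coeff_mu Altruistic N \<gamma> \<kappa> = \<gamma> / N"
| "coeff_mu Welfare N \<gamma> \<kappa> = 0"

fun coeff_tau :: "behavior \<Rightarrow> real \<Rightarrow> real \<Rightarrow> real \<Rightarrow> real" where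
  "coeff_tau Selfish N \<gamma> \<kappa> = \<gamma> / N"
| "coeff_tau Altruistic N \<gamma> \<kappa> = \<gamma> / N"
| "coeff_tau Welfare N \<gamma> \<kappa> = \<kappa> / N"

definition coeff_rho :: "behavior \<Rightarrow> real \<Rightarrow> real \<Rightarrow> real \<Rightarrow> real \<Rightarrow> real" where
  "coeff_rho \<Gamma> N \<gamma> \<kappa> \<alpha> = inverse (2 * (coeff_tau \<Gamma> N \<gamma> \<kappa> + \<alpha>))"


subsection \<open>Information\<close>

text \<open>
  The information of a consumer is a family of observed real numbers indexed by signals.
  The graph is given by its edge set, with the neighbors of i being the j with (i, j) an edge;
  an undirected simple graph is the special case of a symmetric, irreflexive edge set.
\<close>

datatype info_model = Private_Info | Action_Sharing | Broadcast

datatype 'n signal = Own_Preference | Consumption_Of 'n nat | Total_Consumption nat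

fun observed :: "info_model \<Rightarrow> ('n \<times> 'n) set \<Rightarrow> 'n \<Rightarrow> nat \<Rightarrow> 'n signal set" where
  "observed Private_Info E i h = {Own_Preference}"
| "observed Action_Sharing E i h =
     {Own_Preference} \<union> {Consumption_Of j t | j t. (i, j) \<in> E \<and> 1 \<le> t \<and> t < h}"
| "observed Broadcast E i h = {Own_Preference} \<union> {Total_Consumption t | t. 1 \<le> t \<and> t < h}"

abbreviation info_space ::
  "info_model \<Rightarrow> ('n \<times> 'n) set \<Rightarrow> 'n \<Rightarrow> nat \<Rightarrow> ('n signal \<Rightarrow> real) measure" where
  "info_space \<Omega> E i h \<equiv> PiM (observed \<Omega> E i h) (\<lambda>_. borel)"

type_synonym 'n profile = "'n \<Rightarrow> nat \<Rightarrow> ('n signal \<Rightarrow> real) \<Rightarrow> real"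

text \<open>
  Consumptions realized from a strategy profile at preference profile y.  The guards t < h only
  serve termination: every observed signal refers to an earlier slot.
\<close>

fun consumption ::
  "info_model \<Rightarrow> ('n \<times> 'n) set \<Rightarrow> 'n profile \<Rightarrow> real^'n::finite \<Rightarrow> nat \<Rightarrow> 'n \<Rightarrow> real" where
  "consumption \<Omega> E s y h i =
     s i h (\<lambda>k\<in>observed \<Omega> E i h.
       case k of
         Own_Preference \<Rightarrow> y $ i
       | Consumption_Of j t \<Rightarrow> (if t < h then consumption \<Omega> E s y t j else 0)
       | Total_Consumption t \<Rightarrow> (if t < h then (\<Sum>j\<in>UNIV. consumption \<Omega> E s y t j) else 0))"

declare consumption.simps [simp del]

definition info ::
  "info_model \<Rightarrow> ('n \<times> 'n) set \<Rightarrow> 'n profile \<Rightarrow> 'n \<Rightarrow> nat \<Rightarrow> real^'n::finite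
     \<Rightarrow> ('n signal \<Rightarrow> real)" where
  "info \<Omega> E s i h y =
     (\<lambda>k\<in>observed \<Omega> E i h.
       case k of
         Own_Preference \<Rightarrow> y $ i
       | Consumption_Of j t \<Rightarrow> consumption \<Omega> E s y t j
       | Total_Consumption t \<Rightarrow> (\<Sum>j\<in>UNIV. consumption \<Omega> E s y t j))"

lemma consumption_eq: "consumption \<Omega> E s y h i = s i h (info \<Omega> E s i h y)"
proof -
  have "(case k of
         Own_Preference \<Rightarrow> y $ i
       | Consumption_Of j t \<Rightarrow> (if t < h then consumption \<Omega> E s y t j else 0)
       | Total_Consumption t \<Rightarrow> (if t < h then (\<Sum>j\<in>UNIV. consumption \<Omega> E s y t j) else 0)) =
      (case k of
         Own_Preference \<Rightarrow> y $ i
       | Consumption_Of j t \<Rightarrow> consumption \<Omega> E s y t j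
       | Total_Consumption t \<Rightarrow> (\<Sum>j\<in>UNIV. consumption \<Omega> E s y t j))"
    if "k \<in> observed \<Omega> E i h" for k
    using that by (cases \<Omega>) (auto split: signal.split)
  then show ?thesis
    unfolding info_def by (subst consumption.simps) (simp cong: restrict_cong)
qed


subsection \<open>Equilibrium\<close>

text \<open>Here X is the information of one consumer at one slot, with values in the space A.\<close>

definition cond_expect ::
  "'a measure \<Rightarrow> 'b measure \<Rightarrow> ('a \<Rightarrow> 'b) \<Rightarrow> ('a \<Rightarrow> real) \<Rightarrow> 'a \<Rightarrow> real" where
  "cond_expect M A X f = real_cond_exp M (vimage_algebra (space M) X A) f"

definition estimate ::
  "'a measure \<Rightarrow> 'b measure \<Rightarrow> ('a \<Rightarrow> 'b) \<Rightarrow> ('a \<Rightarrow> real^'k::finite) \<Rightarrow> 'a \<Rightarrow> real^'k" where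
  "estimate M A X f x = (\<chi> k. cond_expect M A X (\<lambda>x'. f x' $ k) x)"

text \<open>
  Square integrability makes all expected payoffs finite.  Consumption is real-valued rather than
  nonnegative: a nonconstant linear strategy takes negative values under a normal prior.
\<close>

definition is_strategy ::
  "'a measure \<Rightarrow> 'b measure \<Rightarrow> ('a \<Rightarrow> 'b) \<Rightarrow> ('b \<Rightarrow> real) \<Rightarrow> bool" where
  "is_strategy M A X d \<longleftrightarrow> d \<in> borel_measurable A \<and> integrable M (\<lambda>x. (d (X x))\<^sup>2)"

definition bayes_nash ::
  "'a measure \<Rightarrow> ('a \<Rightarrow> real^'n::finite) \<Rightarrow> (nat \<Rightarrow> 'a \<Rightarrow> real) \<Rightarrow>
   (nat \<Rightarrow> real) \<Rightarrow> (nat \<Rightarrow> real) \<Rightarrow> (nat \<Rightarrow> real) \<Rightarrow>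
   behavior \<Rightarrow> info_model \<Rightarrow> ('n \<times> 'n) set \<Rightarrow> nat set \<Rightarrow> 'n profile \<Rightarrow> bool" where
  "bayes_nash M g \<omega> \<gamma> \<alpha> \<kappa> \<Gamma> \<Omega> E Slots s \<longleftrightarrow>
     (\<forall>i. \<forall>h\<in>Slots. is_strategy M (info_space \<Omega> E i h) (\<lambda>x. info \<Omega> E s i h (g x)) (s i h)) \<and>
     (\<forall>i. \<forall>h\<in>Slots. \<forall>d.
        is_strategy M (info_space \<Omega> E i h) (\<lambda>x. info \<Omega> E s i h (g x)) d \<longrightarrow>
        (AE x in M.
           cond_expect M (info_space \<Omega> E i h) (\<lambda>x. info \<Omega> E s i h (g x))
             (\<lambda>x. payoff (\<gamma> h) (\<alpha> h) (\<kappa> h) \<Gamma> (g x) i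
                ((\<lambda>j. s j h (info \<Omega> E s j h (g x)))(i := d (info \<Omega> E s i h (g x)))) (\<omega> h x)) x
           \<le> cond_expect M (info_space \<Omega> E i h) (\<lambda>x. info \<Omega> E s i h (g x))
             (\<lambda>x. payoff (\<gamma> h) (\<alpha> h) (\<kappa> h) \<Gamma> (g x) i
                (\<lambda>j. s j h (info \<Omega> E s j h (g x))) (\<omega> h x)) x))"

end

theory Submission
  imports Defs
begin

text \<open>
  Each payoff is quadratic and concave in the own action, so a profile is an equilibrium iff at every
  slot the actions satisfy a linear first-order condition on every event of each consumer's
  information.  Multiplying the difference of two solutions with itself and summing over the
  consumers gives a positive definite form, because \<lambda> < 2 (\<tau> + \<alpha>); so the actions of
  a slot are unique.  Inductively over the slots all signals are affine in the preferences, and by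
  invariance of the normal prior under reflections the conditional expectations given such signals
  are orthogonal projections, that is, matrices acting on the augmented profile.  The first-order
  conditions then reduce to the coefficient equations, which are solvable by the same positivity.
\<close>

subsection \<open>Projections for a positive definite form\<close>

text \<open>A second obstacle is a circularity: the information is generated by the very profile
  under study, and equilibrium determines that profile only up to null sets. Past actions are
  therefore tracked as almost sure equalities with affine functions whose coefficients are chosen
  independently of any profile. Comparing every equilibrium with these same coefficients gives
  uniqueness among all square integrable strategies, linear or not. A coefficient vector a stands
  for the random variable a . gtilde. Projecting a by the transpose of T is the same as applying T
  to the profile, hence the transposes in the equations. Constants live on the coordinate
  \<open>None\<close>, where the profile has the value \<open>gbar\<close>; because
  \<open>gbar\<close> is nonzero, every intercept is a multiple of it.\<close>

lemma orthogonal_projection_exists: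
  fixes B :: "'v::real_vector \<Rightarrow> 'v \<Rightarrow> real"
  assumes lin: "\<And>a. linear (\<lambda>b. B b a)" and sym: "\<And>a b. B a b = B b a"
    and pos: "\<And>a. B a a = 0 \<Longrightarrow> a = 0"
    and "finite C"
  shows "\<exists>p\<in>span C. \<forall>c\<in>span C. B (a - p) c = 0"
  using \<open>finite C\<close>
proof (induction C arbitrary: a rule: finite_induct)
  case empty
  have "B b 0 = 0" for b
    using sym linear_0[OF lin, of b] by metis
  then show ?case by auto
next
  case (insert c0 C)
  have lin2: "linear (\<lambda>b. B a b)" for a
    using lin[of a] sym by (simp add: sym)
  obtain p0 where p0: "p0 \<in> span C" "\<And>c. c \<in> span C \<Longrightarrow> B (c0 - p0) c = 0"
    using insert.IH by blast
  obtain p where p: "p \<in> span C" "\<And>c. c \<in> span C \<Longrightarrow> B (a - p) c = 0"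
    using insert.IH by blast
  \<comment> \<open>A Gram-Schmidt step: \<open>q0\<close> is the part of the new vector orthogonal
    to the old span. If \<open>B q0 q0 = 0\<close>, the quotient is 0 by convention, and
    \<open>q0 = 0\<close> by definiteness, so orthogonality to it is trivial.\<close>
  define q0 where "q0 = c0 - p0"
  define p' where "p' = p + (B (a - p) q0 / B q0 q0) *\<^sub>R q0"
  have sub: "span C \<subseteq> span (insert c0 C)" by (rule span_mono) auto
  have q0: "q0 \<in> span (insert c0 C)"
    unfolding q0_def using p0(1) sub by (meson insertI1 span_base span_diff subsetD)
  have p': "p' \<in> span (insert c0 C)"
    unfolding p'_def using p(1) sub q0 by (meson span_add span_scale subsetD)
  have ap: "B (a - p') c = B (a - p) c - B (a - p) q0 / B q0 q0 * B q0 c" for c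
    unfolding p'_def diff_diff_eq[symmetric]
    by (simp add: linear_diff[OF lin] linear_scale[OF lin])
  have C: "B (a - p') c = 0" if "c \<in> span C" for c
    using p(2)[OF that] p0(2)[OF that] by (simp add: ap q0_def)
  have Q: "B (a - p') q0 = 0"
    using pos[of q0] linear_0[OF lin2] by (cases "B q0 q0 = 0") (auto simp: ap)
  have "B (a - p') c = 0" if c: "c \<in> span (insert c0 C)" for c
  proof -
    obtain k where k: "c - k *\<^sub>R c0 \<in> span C"
      using c by (auto simp: span_breakdown_eq)
    have "c = (c - k *\<^sub>R c0 + k *\<^sub>R p0) + k *\<^sub>R q0"
      by (simp add: q0_def algebra_simps)
    moreover have "c - k *\<^sub>R c0 + k *\<^sub>R p0 \<in> span C"
      using k p0(1) by (intro span_add span_scale)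
    ultimately show ?thesis
      using C Q linear_add[OF lin2] linear_scale[OF lin2]
      by (metis add.right_neutral mult_zero_right real_scaleR_def)
  qed
  with p' show ?case by blast
qed

text \<open>Projecting the unit vectors is enough, by linearity. The projections are the rows of T,
  so that the projection itself is the transpose and T can act on the profile.\<close>

lemma projection_matrix_exists:
  fixes B :: "real^'k::finite \<Rightarrow> real^'k \<Rightarrow> real"
  assumes lin: "\<And>a. linear (\<lambda>b. B b a)" and sym: "\<And>a b. B a b = B b a"
    and pos: "\<And>a. B a a = 0 \<Longrightarrow> a = 0"
    and "finite C"
  shows "\<exists>T :: real^'k^'k. \<forall>v. transpose T *v v \<in> span C \<and>
           (\<forall>c\<in>span C. B (v - transpose T *v v) c = 0)"
proof -
  have "\<forall>k. \<exists>p\<in>span C. \<forall>c\<in>span C. B (axis k 1 - p) c = 0"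
    using orthogonal_projection_exists[OF lin sym pos \<open>finite C\<close>] by blast
  then obtain p where p: "\<And>k. p k \<in> span C" "\<And>k c. c \<in> span C \<Longrightarrow> B (axis k 1 - p k) c = 0"
    by metis
  have T: "transpose (\<chi> k. p k) *v v = (\<Sum>k\<in>UNIV. v $ k *\<^sub>R p k)" for v
    by (simp add: vec_eq_iff matrix_vector_mult_def transpose_def mult.commute)
  have v: "v = (\<Sum>k\<in>UNIV. v $ k *\<^sub>R axis k 1)" for v :: "real^'k"
    using basis_expansion[of v] by (simp add: scalar_mult_eq_scaleR)
  have diff: "v - transpose (\<chi> k. p k) *v v = (\<Sum>k\<in>UNIV. v $ k *\<^sub>R (axis k 1 - p k))" for v
    unfolding T by (subst (1) v) (simp add: sum_subtractf scaleR_diff_right)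
  show ?thesis
  proof (intro exI[of _ "\<chi> k. p k"] allI conjI ballI)
    show "transpose (\<chi> k. p k) *v v \<in> span C" for v
      unfolding T by (intro span_sum span_scale p)
    show "B (v - transpose (\<chi> k. p k) *v v) c = 0" if "c \<in> span C" for v c
      unfolding diff by (simp add: linear_sum[OF lin] linear_scale[OF lin] p(2)[OF that])
  qed
qed

text \<open>Completing each cross sum by its own term isolates the square of the total, so for
  \<open>0 \<le> l < k\<close> and a nonnegative form both summands are nonnegative. The bilinear B
  is left abstract because it is instantiated with a form on coefficient vectors and with
  multiplication of real numbers.\<close>

lemma sum_interaction:
  fixes B :: "'v::real_vector \<Rightarrow> 'v \<Rightarrow> real" and v :: "'n::finite \<Rightarrow> 'v"
  assumes lin: "\<And>a. linear (\<lambda>b. B a b)" "\<And>a. linear (\<lambda>b. B b a)"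
  shows "(\<Sum>i\<in>UNIV. B (v i) (k *\<^sub>R v i + l *\<^sub>R (\<Sum>j\<in>UNIV - {i}. v j))) =
    (k - l) * (\<Sum>i\<in>UNIV. B (v i) (v i)) + l * B (\<Sum>i\<in>UNIV. v i) (\<Sum>i\<in>UNIV. v i)"
proof -
  have "k *\<^sub>R v i + l *\<^sub>R (\<Sum>j\<in>UNIV - {i}. v j) = (k - l) *\<^sub>R v i + l *\<^sub>R (\<Sum>j\<in>UNIV. v j)" for i
    by (simp add: sum_diff1 algebra_simps)
  then have "(\<Sum>i\<in>UNIV. B (v i) (k *\<^sub>R v i + l *\<^sub>R (\<Sum>j\<in>UNIV - {i}. v j))) =
      (\<Sum>i\<in>UNIV. (k - l) * B (v i) (v i) + l * B (v i) (\<Sum>j\<in>UNIV. v j))"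
    using linear_add[OF lin(1)] linear_scale[OF lin(1)] by simp
  then show ?thesis
    by (simp add: sum.distrib linear_sum[OF lin(2)] flip: sum_distrib_left)
qed

text \<open>Pairing the i-th homogeneous equation with its unknown and summing shows injectivity.\<close>

lemma coupled_projections_solvable:
  fixes B :: "real^'k::finite \<Rightarrow> real^'k \<Rightarrow> real" and P :: "'n::finite \<Rightarrow> real^'k^'k"
    and b :: "'n \<Rightarrow> real^'k"
  assumes lin: "\<And>a. linear (\<lambda>b. B b a)" and sym: "\<And>a b. B a b = B b a"
    and pos: "\<And>a. 0 \<le> B a a" "\<And>a. B a a = 0 \<Longrightarrow> a = 0"
    and S: "\<And>i. subspace (S i)" and P: "\<And>i v. P i *v v \<in> S i"
      "\<And>i v c. c \<in> S i \<Longrightarrow> B (v - P i *v v) c = 0"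
    and l: "0 \<le> l" "l < 1"
  shows "\<exists>v. \<forall>i. v i + l *\<^sub>R (P i *v (\<Sum>j\<in>UNIV - {i}. v j)) = b i"
proof -
  have lin2: "linear (\<lambda>b. B a b)" for a
    using lin[of a] by (simp add: sym)
  define F :: "real^'k^'n \<Rightarrow> real^'k^'n" where
    "F v = (\<chi> i. v $ i + l *\<^sub>R (P i *v (\<Sum>j\<in>UNIV - {i}. v $ j)))" for v
  have linF: "linear F"
    by (rule linearI)
      (simp_all add: F_def vec_eq_iff sum.distrib matrix_vector_right_distrib scaleR_sum_right[symmetric]
        matrix_vector_mult_scaleR algebra_simps)
  have "v = 0" if "F v = 0" for v
  proof -
    have eq: "v $ i + l *\<^sub>R (P i *v (\<Sum>j\<in>UNIV - {i}. v $ j)) = 0" for i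
      using that by (simp add: F_def vec_eq_iff)
    have vS: "v $ i \<in> S i" for i
    proof -
      have "v $ i = - l *\<^sub>R (P i *v (\<Sum>j\<in>UNIV - {i}. v $ j))"
        using eq[of i] by (simp add: eq_neg_iff_add_eq_0)
      then show ?thesis using P(1) S subspace_scale by metis
    qed
    have "B (v $ i) (1 *\<^sub>R v $ i + l *\<^sub>R (\<Sum>j\<in>UNIV - {i}. v $ j)) = 0" for i
    proof -
      let ?w = "\<Sum>j\<in>UNIV - {i}. v $ j"
      have "1 *\<^sub>R v $ i + l *\<^sub>R ?w = l *\<^sub>R (?w - P i *v ?w)"
        using eq[of i] by (simp add: algebra_simps eq_neg_iff_add_eq_0)
      then have "B (v $ i) (1 *\<^sub>R v $ i + l *\<^sub>R ?w) = l * B (v $ i) (?w - P i *v ?w)"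
        using linear_scale[OF lin2] by simp
      then show ?thesis using P(2)[OF vS] sym by simp
    qed
    then have "(1 - l) * (\<Sum>i\<in>UNIV. B (v $ i) (v $ i)) + l * B (\<Sum>i\<in>UNIV. v $ i) (\<Sum>i\<in>UNIV. v $ i) = 0"
      using sum_interaction[of B "\<lambda>i. v $ i" 1 l] lin lin2 by simp
    moreover have "0 \<le> l * B (\<Sum>i\<in>UNIV. v $ i) (\<Sum>i\<in>UNIV. v $ i)"
      using pos l by simp
    moreover have "0 \<le> (\<Sum>i\<in>UNIV. B (v $ i) (v $ i))"
      using pos by (simp add: sum_nonneg)
    ultimately have "(\<Sum>i\<in>UNIV. B (v $ i) (v $ i)) = 0"
      using l by (smt (verit) mult_pos_pos)
    then have "B (v $ i) (v $ i) = 0" for i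
      using pos by (simp add: sum_nonneg_eq_0_iff)
    then show "v = 0" using pos(2) by (simp add: vec_eq_iff)
  qed
  then have "surj F"
    using linF linear_injective_0 linear_injective_imp_surjective by blast
  then obtain v where "F v = (\<chi> i. b i)" by (metis surjD)
  then show ?thesis
    by (intro exI[of _ "\<lambda>i. v $ i"]) (simp add: F_def vec_eq_iff)
qed

subsection \<open>The normal prior\<close>

text \<open>
  By Fubini, the image measure is a constant multiple of Lebesgue measure; an f-invariant bounded
  open set shows that the constant is 1.
\<close>

lemma lborel_linear_involution:
  fixes f :: "'v::euclidean_space \<Rightarrow> 'v"
  assumes "linear f" and inv: "\<And>x. f (f x) = x"
  shows "distr lborel borel f = lborel"
proof -
  have fm [measurable]: "f \<in> borel_measurable borel"
    using \<open>linear f\<close> by (simp add: borel_measurable_continuous_onI linear_continuous_on linear_conv_bounded_linear)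
  have shift: "(\<integral>\<^sup>+x. h (c + x) \<partial>lborel) = (\<integral>\<^sup>+x. h x \<partial>lborel)"
    if [measurable]: "h \<in> borel_measurable borel" for h :: "'v \<Rightarrow> ennreal" and c
    by (subst lborel_distr_plus[of c, symmetric]) (simp add: nn_integral_distr)
  have flip: "(\<integral>\<^sup>+x. h (c - x) \<partial>lborel) = (\<integral>\<^sup>+x. h x \<partial>lborel)"
    if [measurable]: "h \<in> borel_measurable borel" for h :: "'v \<Rightarrow> ennreal" and c
    by (subst (2) lborel_affine[of "-1" c]) (simp_all add: nn_integral_distr nn_integral_density)
  have exchange: "emeasure lborel (f -` A) * emeasure lborel B = emeasure lborel (f -` B) * emeasure lborel A"
    if [measurable]: "A \<in> sets borel" "B \<in> sets borel" for A B
  proof -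
    have vm: "(\<integral>\<^sup>+x. indicator C (f x) \<partial>lborel) = emeasure lborel (f -` C)"
      if "C \<in> sets borel" for C
      using measurable_sets[OF fm that] by (simp add: indicator_vimage[symmetric])
    have "emeasure lborel (f -` A) * emeasure lborel B =
        (\<integral>\<^sup>+x. (\<integral>\<^sup>+y. indicator A (f x) * indicator B (f x + y) \<partial>lborel) \<partial>lborel)"
      by (simp add: nn_integral_cmult shift[of "indicator B"] nn_integral_multc vm)
    also have "\<dots> = (\<integral>\<^sup>+y. (\<integral>\<^sup>+x. indicator A (f x) * indicator B (f x + y) \<partial>lborel) \<partial>lborel)"
      by (rule lborel_pair.Fubini') measurable
    \<comment> \<open>Translating x by \<open>- f y\<close> turns \<open>f x\<close> into
      \<open>f x - y\<close>, because \<open>f (f y) = y\<close>.\<close>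
    also have "\<dots> = (\<integral>\<^sup>+y. (\<integral>\<^sup>+x. indicator A (f x - y) * indicator B (f x) \<partial>lborel) \<partial>lborel)"
    proof (rule nn_integral_cong)
      fix y
      show "(\<integral>\<^sup>+x. indicator A (f x) * indicator B (f x + y) \<partial>lborel) =
          (\<integral>\<^sup>+x. indicator A (f x - y) * indicator B (f x) \<partial>lborel)"
        using shift[of "\<lambda>x. indicator A (f x) * indicator B (f x + y)" "- f y"]
        by (simp add: linear_diff[OF \<open>linear f\<close>] inv)
    qed
    also have "\<dots> = (\<integral>\<^sup>+x. (\<integral>\<^sup>+y. indicator A (f x - y) * indicator B (f x) \<partial>lborel) \<partial>lborel)"
      by (rule lborel_pair.Fubini'[symmetric]) measurable
    also have "\<dots> = emeasure lborel (f -` B) * emeasure lborel A"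
      by (simp add: nn_integral_cmult nn_integral_multc flip[of "indicator A"] vm mult.commute)
    finally show ?thesis .
  qed
  define B where "B = ball 0 1 \<union> f -` ball 0 1"
  have oB: "open (f -` ball 0 1)"
    using \<open>linear f\<close> by (intro open_vimage linear_continuous_on) (auto simp: linear_conv_bounded_linear)
  have B [measurable]: "B \<in> sets borel"
    unfolding B_def by (rule borel_open) (rule open_Un[OF open_ball oB])
  have "f -` ball 0 1 = f ` ball 0 1"
    using inv by (metis bij_image_Collect_eq  bij_vimage_eq_inv_image involuntory_imp_bij inv_equality)
  then have "bounded B"
    unfolding B_def using \<open>linear f\<close> by (simp add: bounded_linear_image linear_conv_bounded_linear)
  then have fin: "emeasure lborel B < \<infinity>" by (rule emeasure_bounded_finite)
  have "0 < emeasure lborel (ball (0::'v) 1)"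
    using content_ball_pos[of 1 "0::'v"] by (simp add: measure_def enn2real_positive_iff)
  also have "\<dots> \<le> emeasure lborel B" by (rule emeasure_mono) (use B in \<open>auto simp: B_def\<close>)
  finally have pos: "0 < emeasure lborel B" .
  have fB: "f -` B = B" by (auto simp: B_def inv)
  show ?thesis
  proof (rule measure_eqI)
    fix A assume A: "A \<in> sets (distr lborel borel f)"
    then have "emeasure lborel (f -` A) * emeasure lborel B = emeasure lborel A * emeasure lborel B"
      using exchange[of A B] fB by (simp add: mult.commute)
    then have "emeasure lborel (f -` A) = emeasure lborel A"
      using pos fin by (metis ennreal_mult_divide_eq infinity_ennreal_def less_irrefl)
    then show "emeasure (distr lborel borel f) A = emeasure lborel A"
      using A by (simp add: emeasure_distr)
  qed simp
qed

section \<open>A positive definite matrix and the quadratic form of its inverse\<close>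

lemma pos_def_matrix_inv:
  assumes "pos_def_matrix \<Sigma>"
  shows "\<Sigma> *v (matrix_inv \<Sigma> *v x) = x" "matrix_inv \<Sigma> *v (\<Sigma> *v x) = x"
proof -
  have "inj ((*v) \<Sigma>)"
    using assms by (intro linear_injective_0[THEN iffD2] matrix_vector_mul_linear)
      (auto simp: pos_def_matrix_def)
  then have "invertible \<Sigma>"
    using invertible_left_inverse matrix_left_invertible_injective by blast
  then show "\<Sigma> *v (matrix_inv \<Sigma> *v x) = x" "matrix_inv \<Sigma> *v (\<Sigma> *v x) = x"
    unfolding matrix_vector_mul_assoc matrix_inv_def invertible_def
    by (metis (mono_tags, lifting) matrix_vector_mul_lid someI_ex)+
qed

lemma pos_def_matrix_symmetric:
  assumes "pos_def_matrix \<Sigma>"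
  shows "x \<bullet> (\<Sigma> *v y) = (\<Sigma> *v x) \<bullet> y"
  using assms dot_lmul_matrix[of x \<Sigma> y] by (simp add: pos_def_matrix_def flip: transpose_matrix_vector)

text \<open>In the direction \<open>\<Sigma> *v q\<close> the inverse cancels, leaving a quadratic
  polynomial in t without any inverse in its coefficients. Its minimizer gives the Cauchy-Schwarz
  bound; twice the minimizer is the reflection, where the two t-terms cancel.\<close>

lemma inverse_form_shift:
  assumes "pos_def_matrix \<Sigma>"
  shows "(z - t *\<^sub>R (\<Sigma> *v q)) \<bullet> (matrix_inv \<Sigma> *v (z - t *\<^sub>R (\<Sigma> *v q))) =
    z \<bullet> (matrix_inv \<Sigma> *v z) - 2 * t * (q \<bullet> z) + t\<^sup>2 * (q \<bullet> (\<Sigma> *v q))"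
proof -
  have "(\<Sigma> *v q) \<bullet> (matrix_inv \<Sigma> *v z) = q \<bullet> z"
    using pos_def_matrix_symmetric[OF assms] pos_def_matrix_inv[OF assms] by metis
  then show ?thesis
    using inner_commute[of z q] inner_commute[of "\<Sigma> *v q" q]
    by (simp add: matrix_vector_mult_diff_distrib matrix_vector_mult_scaleR pos_def_matrix_inv[OF assms]
      inner_diff_left inner_diff_right power2_eq_square algebra_simps)
qed

text \<open>Cauchy-Schwarz for the dual norms of \<Sigma> and its inverse: \<open>w\<close>
  minimizes the inverse form along the line through z in direction \<open>\<Sigma> *v q\<close>, and
  the minimum is nonnegative.\<close>

lemma inverse_form_bounds_inner:
  assumes "pos_def_matrix \<Sigma>"
  shows "(q \<bullet> z)\<^sup>2 \<le> (q \<bullet> (\<Sigma> *v q)) * (z \<bullet> (matrix_inv \<Sigma> *v z))"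
proof (cases "q = 0")
  case False
  define c where "c = q \<bullet> (\<Sigma> *v q)"
  have c: "0 < c" using False assms by (simp add: c_def pos_def_matrix_def)
  define w where "w = z - ((q \<bullet> z) / c) *\<^sub>R (\<Sigma> *v q)"
  have "0 \<le> w \<bullet> (matrix_inv \<Sigma> *v w)"
    using assms pos_def_matrix_inv[OF assms, of w]
    by (cases "matrix_inv \<Sigma> *v w = 0") (auto simp: pos_def_matrix_def inner_commute dest!: spec[of _ "matrix_inv \<Sigma> *v w"])
  also have "w \<bullet> (matrix_inv \<Sigma> *v w) =
      z \<bullet> (matrix_inv \<Sigma> *v z) - 2 * ((q \<bullet> z) / c) * (q \<bullet> z) + ((q \<bullet> z) / c)\<^sup>2 * c"
    unfolding w_def inverse_form_shift[OF assms] c_def[symmetric] ..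
  also have "\<dots> = z \<bullet> (matrix_inv \<Sigma> *v z) - (q \<bullet> z)\<^sup>2 / c"
    using c by (simp add: field_simps power2_eq_square)
  finally show ?thesis
    using c unfolding c_def[symmetric] by (simp add: field_simps)
qed simp

locale normal_prior = prob_space M for M :: "'a measure" +
  fixes g :: "'a \<Rightarrow> real^'n::finite" and gbar :: real and \<Sigma> :: "real^'n^'n"
  assumes gbar_pos: "0 < gbar" and pos_def: "pos_def_matrix \<Sigma>"
    and prior: "distributed M lborel g (\<lambda>y. ennreal (mvnormal_density (\<chi> i. gbar) \<Sigma> y))"
begin

abbreviation mean_profile :: "real^'n" where "mean_profile \<equiv> (\<chi> i. gbar)"

definition inv_form :: "real^'n \<Rightarrow> real" where
  "inv_form z = z \<bullet> (matrix_inv \<Sigma> *v z)"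

definition normalizer :: real where
  "normalizer = 1 / sqrt ((2 * pi) ^ CARD('n) * det \<Sigma>)"

lemma g_measurable [measurable]: "g \<in> borel_measurable M"
  using distributed_measurable[OF prior] by simp

lemma density_eq: "mvnormal_density mean_profile \<Sigma> y = normalizer * exp (- inv_form (y - mean_profile) / 2)"
  by (simp add: mvnormal_density_def normalizer_def inv_form_def)

lemma inv_form_measurable [measurable]: "inv_form \<in> borel_measurable borel"
  unfolding inv_form_def[abs_def]
  by (intro borel_measurable_continuous_onI continuous_intros linear_continuous_on
    linear_conv_bounded_linear[THEN iffD1] matrix_vector_mul_linear)

lemma prior_total_mass: "(\<integral>\<^sup>+y. ennreal (mvnormal_density mean_profile \<Sigma> y) \<partial>lborel) = 1"
  using distributed_nn_integral[OF prior, of "\<lambda>_. 1"] by (simp add: emeasure_space_1)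

text \<open>The sign comes from the total mass instead of the determinant: with a nonpositive factor
  the density would be nonpositive everywhere and could not have mass 1.\<close>

lemma normalizer_pos: "0 < normalizer"
proof (rule ccontr)
  assume "\<not> 0 < normalizer"
  then have "mvnormal_density mean_profile \<Sigma> y \<le> 0" for y
    by (simp add: density_eq mult_nonpos_nonneg)
  then show False using prior_total_mass by (simp add: ennreal_neg)
qed

lemma density_nonneg: "0 \<le> mvnormal_density mean_profile \<Sigma> y"
  using normalizer_pos by (simp add: density_eq)

lemma density_measurable [measurable]: "mvnormal_density mean_profile \<Sigma> \<in> borel_measurable borel"
  unfolding density_eq[abs_def] by measurable

text \<open>Dilating by \<open>sqrt 2\<close> about the mean doubles the form and turns this
  integral into a multiple of the known total mass, so no Gaussian integral is evaluated. The
  function serves as the integrable majorant for second moments.\<close>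

lemma widened_density_finite: "(\<integral>\<^sup>+y. ennreal (exp (- inv_form (y - mean_profile) / 4)) \<partial>lborel) < \<infinity>"
proof -
  let ?m = mean_profile
  have sq: "inv_form (sqrt 2 *\<^sub>R z) = 2 * inv_form z" for z
    by (simp add: inv_form_def matrix_vector_mult_scaleR)
  have shift: "?m - sqrt 2 *\<^sub>R ?m + sqrt 2 *\<^sub>R y - ?m = sqrt 2 *\<^sub>R (y - ?m)" for y
    by (simp add: algebra_simps)
  define c :: ennreal where "c = ennreal (\<bar>sqrt 2\<bar> ^ DIM(real^'n))"
  have "ennreal (exp (- inv_form (y - ?m) / 2)) =
      ennreal (1 / normalizer) * ennreal (mvnormal_density ?m \<Sigma> y)" for y
    using normalizer_pos by (simp add: density_eq flip: ennreal_mult')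
  then have fin: "(\<integral>\<^sup>+y. ennreal (exp (- inv_form (y - ?m) / 2)) \<partial>lborel) = ennreal (1 / normalizer)"
    using prior_total_mass by (simp add: nn_integral_cmult)
  have "(\<integral>\<^sup>+y. ennreal (exp (- inv_form (y - ?m) / 4)) \<partial>lborel) =
      (\<integral>\<^sup>+y. c * ennreal (exp (- inv_form ((?m - sqrt 2 *\<^sub>R ?m + sqrt 2 *\<^sub>R y) - ?m) / 4)) \<partial>lborel)"
    by (subst lborel_affine[of "sqrt 2" "?m - sqrt 2 *\<^sub>R ?m"])
      (simp_all add: nn_integral_density nn_integral_distr c_def ennreal_power)
  also have "\<dots> = c * ennreal (1 / normalizer)"
    unfolding shift sq using fin by (simp add: nn_integral_cmult)
  also have "\<dots> < \<infinity>" by (simp add: c_def ennreal_mult_less_top)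
  finally show ?thesis .
qed

text \<open>Half of the exponential decay absorbs the square: with t the form in the exponent, the
  square is at most a constant times t, and \<open>t / 4 \<le> exp (t / 4)\<close> yields the factor
  4 and the exponent \<open>- t / 4\<close>.\<close>

lemma centered_square_integrable: "integrable M (\<lambda>x. (u \<bullet> (g x - mean_profile))\<^sup>2)"
proof (rule integrableI_nonneg)
  let ?m = mean_profile
  define C where "C = normalizer * (u \<bullet> (\<Sigma> *v u)) * 4"
  have u: "0 \<le> u \<bullet> (\<Sigma> *v u)"
    using pos_def by (cases "u = 0") (auto simp: pos_def_matrix_def intro: less_imp_le)
  have bound: "mvnormal_density ?m \<Sigma> y * (u \<bullet> (y - ?m))\<^sup>2 \<le> C * exp (- inv_form (y - ?m) / 4)" for y
  proof -
    define t where "t = inv_form (y - ?m)"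
    have "t / 4 \<le> exp (t / 4)" using exp_ge_add_one_self[of "t / 4"] by linarith
    then have "t * exp (- t / 2) \<le> 4 * exp (t / 4) * exp (- t / 2)" by simp
    also have "\<dots> = 4 * exp (- t / 4)"
      by (simp add: field_simps flip: exp_add)
    finally have t: "t * exp (- t / 2) \<le> 4 * exp (- t / 4)" .
    have "(u \<bullet> (y - ?m))\<^sup>2 \<le> (u \<bullet> (\<Sigma> *v u)) * t"
      using inverse_form_bounds_inner[OF pos_def] by (simp add: t_def inv_form_def)
    then have "mvnormal_density ?m \<Sigma> y * (u \<bullet> (y - ?m))\<^sup>2 \<le>
        mvnormal_density ?m \<Sigma> y * ((u \<bullet> (\<Sigma> *v u)) * t)"
      using density_nonneg by (intro mult_left_mono)
    also have "\<dots> = normalizer * (u \<bullet> (\<Sigma> *v u)) * (t * exp (- t / 2))"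
      by (simp add: density_eq t_def)
    also have "\<dots> \<le> normalizer * (u \<bullet> (\<Sigma> *v u)) * (4 * exp (- t / 4))"
      using t u normalizer_pos by (intro mult_left_mono) auto
    finally show ?thesis by (simp add: C_def t_def)
  qed
  have "(\<integral>\<^sup>+x. ennreal ((u \<bullet> (g x - ?m))\<^sup>2) \<partial>M) =
      (\<integral>\<^sup>+y. ennreal (mvnormal_density ?m \<Sigma> y) * ennreal ((u \<bullet> (y - ?m))\<^sup>2) \<partial>lborel)"
    by (rule distributed_nn_integral[OF prior, symmetric]) simp
  also have "\<dots> \<le> (\<integral>\<^sup>+y. ennreal C * ennreal (exp (- inv_form (y - ?m) / 4)) \<partial>lborel)"
    using bound u normalizer_pos
    by (intro nn_integral_mono) (simp add: C_def density_nonneg flip: ennreal_mult' ennreal_mult'')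
  also have "\<dots> < \<infinity>"
    using widened_density_finite by (simp add: nn_integral_cmult ennreal_mult_less_top)
  finally show "(\<integral>\<^sup>+x. ennreal ((u \<bullet> (g x - ?m))\<^sup>2) \<partial>M) < \<infinity>" .
qed simp_all

text \<open>
  This reflection is an isometry of the quadratic form in the exponent of the density and an affine
  involution, hence volume preserving, so the prior is invariant under it.
\<close>

definition reflect :: "real^'n \<Rightarrow> real^'n \<Rightarrow> real^'n" where
  "reflect q y = y - (2 * (q \<bullet> (y - mean_profile)) / (q \<bullet> (\<Sigma> *v q))) *\<^sub>R (\<Sigma> *v q)"

lemma reflect_inner:
  assumes "p \<bullet> (\<Sigma> *v q) = 0"
  shows "p \<bullet> reflect q y = p \<bullet> y"
  using assms by (simp add: reflect_def inner_diff_right)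

lemma reflect_inner_self:
  assumes "q \<noteq> 0"
  shows "q \<bullet> (reflect q y - mean_profile) = - (q \<bullet> (y - mean_profile))"
proof -
  have "q \<bullet> (\<Sigma> *v q) \<noteq> 0" using assms pos_def by (auto simp: pos_def_matrix_def)
  then show ?thesis by (simp add: reflect_def inner_diff_right)
qed

lemma reflect_preserves_lborel:
  assumes "q \<noteq> 0"
  shows "distr lborel borel (reflect q) = lborel"
proof -
  let ?m = mean_profile
  define c where "c = q \<bullet> (\<Sigma> *v q)"
  have c: "c \<noteq> 0" using assms pos_def by (auto simp: pos_def_matrix_def c_def)
  define L where "L z = z - (2 * (q \<bullet> z) / c) *\<^sub>R (\<Sigma> *v q)" for z
  have lin: "linear L"
    by (rule linearI) (simp_all add: L_def inner_add_right algebra_simps add_divide_distrib scaleR_add_left)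
  have inv: "L (L z) = z" for z
    using c by (simp add: L_def inner_diff_right c_def[symmetric] algebra_simps flip: scaleR_add_left)
  have [measurable]: "L \<in> borel_measurable borel"
    using lin by (simp add: borel_measurable_continuous_onI linear_continuous_on linear_conv_bounded_linear)
  have "reflect q = (+) ?m \<circ> (L \<circ> (+) (- ?m))"
    \<comment> \<open>Moving the mean to the origin conjugates the affine reflection to the linear
      involution \<open>L\<close>; translations preserve Lebesgue measure.\<close>
    by (auto simp: fun_eq_iff reflect_def L_def c_def)
  then have "distr lborel borel (reflect q) =
      distr (distr (distr lborel borel ((+) (- ?m))) borel L) borel ((+) ?m)"
    by (simp add: distr_distr)
  then show ?thesis
    by (simp add: lborel_distr_plus lborel_linear_involution[OF lin inv])
qed

lemma reflect_measurable [measurable]: "reflect q \<in> borel_measurable borel"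
  unfolding reflect_def[abs_def] by measurable

lemma expectation_reflect:
  fixes \<phi> :: "real^'n \<Rightarrow> real"
  assumes "q \<noteq> 0" and [measurable]: "\<phi> \<in> borel_measurable borel"
  shows "(\<integral>x. \<phi> (reflect q (g x)) \<partial>M) = (\<integral>x. \<phi> (g x) \<partial>M)"
proof -
  let ?m = mean_profile
  let ?f = "mvnormal_density ?m \<Sigma>"
  have c: "q \<bullet> (\<Sigma> *v q) \<noteq> 0" using assms pos_def by (auto simp: pos_def_matrix_def)
  have "inv_form (reflect q y - ?m) = inv_form (y - ?m)" for y
  proof -
    have "reflect q y - ?m = (y - ?m) - (2 * (q \<bullet> (y - ?m)) / (q \<bullet> (\<Sigma> *v q))) *\<^sub>R (\<Sigma> *v q)"
      by (simp add: reflect_def)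
    then show ?thesis
      unfolding inv_form_def
      by (simp only: inverse_form_shift[OF pos_def]) (use c in \<open>simp add: field_simps power2_eq_square\<close>)
  qed
  then have f: "?f (reflect q y) = ?f y" for y by (simp add: density_eq)
  have "(\<integral>x. \<phi> (reflect q (g x)) \<partial>M) = (\<integral>y. ?f y * \<phi> (reflect q y) \<partial>lborel)"
    by (rule distributed_integral[OF prior, symmetric]) (simp_all add: density_nonneg)
  also have "\<dots> = (\<integral>y. ?f (reflect q y) * \<phi> (reflect q y) \<partial>lborel)" by (simp add: f)
  also have "\<dots> = (\<integral>y. ?f y * \<phi> y \<partial>distr lborel borel (reflect q))"
    by (rule integral_distr[symmetric]) simp_all
  also have "\<dots> = (\<integral>y. ?f y * \<phi> y \<partial>lborel)" by (simp add: reflect_preserves_lborel[OF \<open>q \<noteq> 0\<close>])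
  also have "\<dots> = (\<integral>x. \<phi> (g x) \<partial>M)"
    by (rule distributed_integral[OF prior]) (simp_all add: density_nonneg)
  finally show ?thesis .
qed

end

subsection \<open>Conditional expectations given affine signals\<close>

definition square_integrable :: "'a measure \<Rightarrow> ('a \<Rightarrow> real) \<Rightarrow> bool" where
  "square_integrable M f \<longleftrightarrow> f \<in> borel_measurable M \<and> integrable M (\<lambda>x. (f x)\<^sup>2)"

lemma square_integrable_measurable: "square_integrable M f \<Longrightarrow> f \<in> borel_measurable M"
  by (simp add: square_integrable_def)

lemma square_integrable_mult:
  assumes "square_integrable M f" "square_integrable M g"
  shows "integrable M (\<lambda>x. f x * g x)"
proof (rule Bochner_Integration.integrable_bound)
  show "integrable M (\<lambda>x. (f x)\<^sup>2 + (g x)\<^sup>2)"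
    using assms by (simp add: square_integrable_def)
  show "(\<lambda>x. f x * g x) \<in> borel_measurable M"
    using assms by (auto simp: square_integrable_def intro: borel_measurable_times)
  have "\<bar>a * b\<bar> \<le> a\<^sup>2 + b\<^sup>2" for a b :: real
    using sum_squares_bound[of "\<bar>a\<bar>" "\<bar>b\<bar>"] abs_ge_zero[of "a * b"]
    unfolding abs_mult power2_abs by linarith
  then show "AE x in M. norm (f x * g x) \<le> norm ((f x)\<^sup>2 + (g x)\<^sup>2)"
    by (simp add: abs_of_nonneg)
qed

lemma square_integrable_add:
  assumes "square_integrable M f" "square_integrable M g"
  shows "square_integrable M (\<lambda>x. f x + g x)"
  using assms square_integrable_mult[OF assms]
  by (auto simp: square_integrable_def power2_sum mult.assoc intro!: borel_measurable_add)

lemma square_integrable_cmult: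
  "square_integrable M f \<Longrightarrow> square_integrable M (\<lambda>x. c * f x)"
  by (auto simp: square_integrable_def power_mult_distrib intro!: borel_measurable_times)

lemma square_integrable_diff:
  assumes "square_integrable M f" "square_integrable M g"
  shows "square_integrable M (\<lambda>x. f x - g x)"
  using square_integrable_add[OF assms(1) square_integrable_cmult[OF assms(2), of "-1"]] by simp

lemma (in finite_measure) square_integrable_const: "square_integrable M (\<lambda>x. c)"
  by (simp add: square_integrable_def)

lemma (in finite_measure) square_integrable_sum:
  "(\<And>i. i \<in> A \<Longrightarrow> square_integrable M (f i)) \<Longrightarrow> square_integrable M (\<lambda>x. \<Sum>i\<in>A. f i x)"
  by (induction A rule: infinite_finite_induct)
    (auto intro: square_integrable_const square_integrable_add)

lemma (in finite_measure) integrable_if_square_integrable: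
  "square_integrable M f \<Longrightarrow> integrable M f"
  using square_integrable_mult[OF _ square_integrable_const[of 1]] by simp

lemma (in finite_measure) square_integrable_indicator:
  "A \<in> sets M \<Longrightarrow> square_integrable M (indicator A)"
  by (simp add: square_integrable_def power2_eq_square less_top[symmetric] flip: indicator_inter_arith)

text \<open>Vanishing on all events of F says that the conditional expectation of D given F is 0,
  and the F-measurable factor can be pulled out of it. This upgrades a condition on events to one
  tested against differences of actions.\<close>

lemma (in finite_measure) integral_mult_eq_0:
  fixes f D :: "'a \<Rightarrow> real"
  assumes sub: "subalgebra M F" and [measurable]: "f \<in> borel_measurable F"
    and D: "integrable M D" and fD: "integrable M (\<lambda>x. f x * D x)"
    and zero: "\<And>A. A \<in> sets F \<Longrightarrow> (\<integral>x\<in>A. D x \<partial>M) = 0"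
  shows "(\<integral>x. f x * D x \<partial>M) = 0"
proof -
  interpret finite_measure_subalgebra M F by unfold_locales fact
  have [measurable]: "f \<in> borel_measurable M" using measurable_from_subalg[OF sub assms(2)] .
  have "AE x in M. real_cond_exp M F D x = 0"
    using zero D by (intro real_cond_exp_charact) (auto simp: set_lebesgue_integral_def)
  then have "(\<integral>x. f x * real_cond_exp M F D x \<partial>M) = (\<integral>x. 0 \<partial>M)"
    by (intro integral_cong_AE borel_measurable_times borel_measurable_cond_exp2) auto
  then show ?thesis
    using real_cond_exp_intg(2)[OF fD] D by simp
qed

lemma linear_times_right: "linear (\<lambda>b. b * (a :: real))"
  by (rule linearI) (simp_all add: algebra_simps)

text \<open>Summing the products of the i-th condition with the i-th unknown leaves a positive definite form.\<close>

lemma (in finite_measure) coupled_conditions_trivial: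
  fixes \<delta> :: "'n::finite \<Rightarrow> 'a \<Rightarrow> real"
  assumes sub: "\<And>i. subalgebra M (F i)" and sq: "\<And>i. square_integrable M (\<delta> i)"
    and repr: "\<And>i. \<exists>f\<in>borel_measurable (F i). AE x in M. \<delta> i x = f x"
    and zero: "\<And>i A. A \<in> sets (F i) \<Longrightarrow> (\<integral>x\<in>A. k * \<delta> i x + l * (\<Sum>j\<in>UNIV - {i}. \<delta> j x) \<partial>M) = 0"
    and kl: "0 \<le> l" "l < k"
  shows "AE x in M. \<delta> i x = 0"
proof -
  define D where "D i x = k * \<delta> i x + l * (\<Sum>j\<in>UNIV - {i}. \<delta> j x)" for i x
  have D: "square_integrable M (D i)" for i
    unfolding D_def by (intro square_integrable_add square_integrable_cmult square_integrable_sum sq)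
  note [measurable] = square_integrable_measurable[OF D] square_integrable_measurable[OF sq]
  have "(\<integral>x. \<delta> i x * D i x \<partial>M) = 0" for i
  proof -
    \<comment> \<open>The difference is measurable for the information only after a change on a null
      set, so the test is made with a measurable version.\<close>
    obtain f where f: "f \<in> borel_measurable (F i)" "AE x in M. \<delta> i x = f x" using repr by blast
    have fM [measurable]: "f \<in> borel_measurable M" using measurable_from_subalg[OF sub f(1)] .
    have ae: "AE x in M. \<delta> i x * D i x = f x * D i x" using f(2) by eventually_elim simp
    have "integrable M (\<lambda>x. f x * D i x)"
      using square_integrable_mult[OF sq D] by (subst integrable_cong_AE[OF _ _ AE_symmetric[OF ae]]) auto
    then have "(\<integral>x. f x * D i x \<partial>M) = 0"
      using zero[folded D_def] by (rule integral_mult_eq_0[OF sub f(1) integrable_if_square_integrable[OF D]])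
    then show ?thesis using integral_cong_AE[OF _ _ ae] by auto
  qed
  then have "0 = (\<integral>x. (\<Sum>i\<in>UNIV. \<delta> i x * D i x) \<partial>M)"
    using square_integrable_mult[OF sq D] by simp
  also have "\<dots> = (\<integral>x. (k - l) * (\<Sum>i\<in>UNIV. (\<delta> i x)\<^sup>2) + l * (\<Sum>i\<in>UNIV. \<delta> i x)\<^sup>2 \<partial>M)"
  proof -
    have "(\<Sum>i\<in>UNIV. \<delta> i x * D i x) = (k - l) * (\<Sum>i\<in>UNIV. (\<delta> i x)\<^sup>2) + l * (\<Sum>i\<in>UNIV. \<delta> i x)\<^sup>2" for x
      using sum_interaction[of "(*)" "\<lambda>i. \<delta> i x" k l]
      by (simp add: D_def power2_eq_square linear_times linear_times_right)
    then show ?thesis by simp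
  qed
  also have "\<dots> \<ge> (\<integral>x. (k - l) * (\<delta> i x)\<^sup>2 \<partial>M)"
  proof (rule integral_mono)
    show "integrable M (\<lambda>x. (k - l) * (\<delta> i x)\<^sup>2)"
      using sq[of i] by (simp add: square_integrable_def)
    show "integrable M (\<lambda>x. (k - l) * (\<Sum>i\<in>UNIV. (\<delta> i x)\<^sup>2) + l * (\<Sum>i\<in>UNIV. \<delta> i x)\<^sup>2)"
      using sq square_integrable_sum[of UNIV \<delta>] by (simp add: square_integrable_def)
    show "(k - l) * (\<delta> i x)\<^sup>2 \<le> (k - l) * (\<Sum>i\<in>UNIV. (\<delta> i x)\<^sup>2) + l * (\<Sum>i\<in>UNIV. \<delta> i x)\<^sup>2" for x
      using kl member_le_sum[of i UNIV "\<lambda>i. (\<delta> i x)\<^sup>2"] by (simp add: add_increasing2)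
  qed
  finally have "(k - l) * (\<integral>x. (\<delta> i x)\<^sup>2 \<partial>M) \<le> 0" using sq[of i] by (simp add: square_integrable_def)
  then have "(\<integral>x. (\<delta> i x)\<^sup>2 \<partial>M) \<le> 0" using kl by (simp add: mult_le_0_iff)
  moreover have "0 \<le> (\<integral>x. (\<delta> i x)\<^sup>2 \<partial>M)" by simp
  ultimately have "(\<integral>x. (\<delta> i x)\<^sup>2 \<partial>M) = 0" by linarith
  then have "AE x in M. (\<delta> i x)\<^sup>2 = 0"
    using sq[of i] by (subst (asm) integral_nonneg_eq_0_iff_AE) (auto simp: square_integrable_def)
  then show ?thesis by simp
qed

section \<open>Coefficient vectors of affine functions of the preferences\<close>

context normal_prior
begin

definition slope :: "real^('n option) \<Rightarrow> real^'n" where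
  "slope a = (\<chi> i. a $ Some i)"

text \<open>The value of a . gtilde at the mean profile, where all coordinates equal
  \<open>gbar\<close>.\<close>

definition level :: "real^('n option) \<Rightarrow> real" where
  "level a = gbar * (\<Sum>k\<in>UNIV. a $ k)"

text \<open>
  This is the second moment E[(a \<bullet> gtilde) (b \<bullet> gtilde)], but only its orthogonality relation
  matters, so the covariance of the density is never computed.
\<close>

definition form :: "real^('n option) \<Rightarrow> real^('n option) \<Rightarrow> real" where
  "form a b = slope a \<bullet> (\<Sigma> *v slope b) + level a * level b"

abbreviation gtilde :: "'a \<Rightarrow> real^('n option)" where
  "gtilde x \<equiv> augment gbar (g x)"

lemma inner_augment: "a \<bullet> augment gbar y = slope a \<bullet> (y - mean_profile) + level a"
proof -
  have split: "sum f (UNIV :: 'n option set) = f None + (\<Sum>i\<in>UNIV. f (Some i))" for f :: "'n option \<Rightarrow> real"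
    unfolding UNIV_option_conv by (subst sum.insert) (auto simp: sum.reindex)
  show ?thesis
    by (simp add: inner_vec_def augment_def slope_def level_def split sum_subtractf sum_distrib_left algebra_simps)
qed

lemma linear_slope: "linear slope"
  by (rule linearI) (simp_all add: slope_def vec_eq_iff)

lemma linear_level: "linear level"
  by (rule linearI) (simp_all add: level_def sum.distrib sum_distrib_left algebra_simps)

lemma form_sym: "form a b = form b a"
  unfolding form_def using pos_def_matrix_symmetric[OF pos_def] by (simp add: inner_commute mult.commute)

lemma linear_form: "linear (\<lambda>b. form b a)"
  by (rule linearI)
    (simp_all add: form_def linear_add[OF linear_slope] linear_scale[OF linear_slope]
      linear_add[OF linear_level] linear_scale[OF linear_level] inner_add_left algebra_simps)

lemma form_nonneg: "0 \<le> form a a"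
proof -
  have "0 \<le> slope a \<bullet> (\<Sigma> *v slope a)"
    using pos_def by (cases "slope a = 0") (auto simp: pos_def_matrix_def intro: less_imp_le)
  then show ?thesis by (simp add: form_def)
qed

text \<open>Without slope only the constant coordinate remains, and there \<open>level\<close> is
  multiplication by \<open>gbar\<close>, which is nonzero.\<close>

lemma eq_0_if_slope_level: "slope a = 0 \<Longrightarrow> level a = 0 \<Longrightarrow> a = 0"
proof -
  assume a: "slope a = 0" "level a = 0"
  have "a $ Some i = 0" for i using a(1) by (simp add: slope_def vec_eq_iff)
  moreover from this have "(\<Sum>k\<in>UNIV. a $ k) = a $ None"
    unfolding UNIV_option_conv by (subst sum.insert) (auto simp: sum.reindex)
  ultimately show "a = 0"
    using a(2) gbar_pos by (auto simp: level_def vec_eq_iff split_option_all)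
qed

lemma form_definite: "form a a = 0 \<Longrightarrow> a = 0"
proof -
  assume z: "form a a = 0"
  have "0 < slope a \<bullet> (\<Sigma> *v slope a)" if "slope a \<noteq> 0"
    using pos_def that by (auto simp: pos_def_matrix_def)
  then have "slope a = 0"
    using z by (smt (verit) form_def zero_le_square)
  then show "a = 0" using z by (intro eq_0_if_slope_level) (auto simp: form_def)
qed

lemma slope_axis_None: "slope (axis None 1) = 0" and level_axis_None: "level (axis None 1) = gbar"
  by (simp_all add: slope_def level_def vec_eq_iff axis_def)

lemma square_integrable_affine: "square_integrable M (\<lambda>x. a \<bullet> gtilde x)"
  unfolding inner_augment
  by (intro square_integrable_add square_integrable_const)
    (simp add: square_integrable_def centered_square_integrable)

end

text \<open>The sigma-algebra comes from the actual information \<open>X\<close>, which in an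
  equilibrium agrees with affine signals only almost surely. The coefficients may be linearly
  dependent.\<close>

locale linear_signals = normal_prior M g gbar \<Sigma>
  for M :: "'a measure" and g :: "'a \<Rightarrow> real^'n::finite" and gbar \<Sigma> +
  fixes K :: "'s set" and X :: "'a \<Rightarrow> 's \<Rightarrow> real" and c :: "'s \<Rightarrow> real^('n option)"
  assumes K: "finite K" and X [measurable]: "X \<in> M \<rightarrow>\<^sub>M PiM K (\<lambda>_. borel)"
    and X_eq: "k \<in> K \<Longrightarrow> AE x in M. X x k = c k \<bullet> gtilde x"
begin

text \<open>The vector \<open>axis None 1\<close> represents the constant \<open>gbar\<close>; with
  it in the span, orthogonality to the span includes having level 0.\<close>

definition signal_span :: "(real^('n option)) set" where
  "signal_span = span (insert (axis None 1) (c ` K))"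

abbreviation signal_algebra :: "'a measure" where
  "signal_algebra \<equiv> vimage_algebra (space M) X (PiM K (\<lambda>_. borel))"

lemma subalgebra: "subalgebra M signal_algebra"
  using measurable_space[OF X] measurable_sets[OF X] by (auto simp: subalgebra_def sets_vimage_algebra2)

lemma X_measurable: "X \<in> signal_algebra \<rightarrow>\<^sub>M PiM K (\<lambda>_. borel)"
  using measurable_space[OF X] by (intro measurable_vimage_algebra1) blast

lemma AE_X: "AE x in M. X x = (\<lambda>k\<in>K. c k \<bullet> gtilde x)"
proof -
  have "AE x in M. \<forall>k\<in>K. X x k = c k \<bullet> gtilde x"
    using K X_eq by (simp add: AE_finite_all)
  then show ?thesis
  proof (rule AE_mp, intro AE_I2 impI)
    fix x assume "x \<in> space M" and eq: "\<forall>k\<in>K. X x k = c k \<bullet> gtilde x"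
    then have "X x \<in> extensional K" using measurable_space[OF X] by (auto simp: space_PiM PiE_def)
    then show "X x = (\<lambda>k\<in>K. c k \<bullet> gtilde x)"
      using eq by (auto simp: fun_eq_iff extensional_def)
  qed
qed

text \<open>
  The reflection along q leaves the signals unchanged and negates q \<bullet> gtilde, which therefore has
  mean zero on every event decided by the signals.
\<close>

lemma set_integral_orthogonal:
  assumes orth: "\<And>p. p \<in> signal_span \<Longrightarrow> form q p = 0" and A: "A \<in> sets signal_algebra"
  shows "(\<integral>x\<in>A. q \<bullet> gtilde x \<partial>M) = 0"
proof (cases "slope q = 0")
  case True
  have "form q (axis None 1) = 0" using orth by (simp add: signal_span_def span_base)
  then have "level q = 0" using gbar_pos by (simp add: form_def slope_axis_None level_axis_None)
  then show ?thesis using True by (simp add: inner_augment)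
next
  case False
  let ?Y = "\<lambda>y. \<lambda>k\<in>K. c k \<bullet> augment gbar y"
  have "form q (axis None 1) = 0" using orth by (simp add: signal_span_def span_base)
  then have lev: "level q = 0" using gbar_pos by (simp add: form_def slope_axis_None level_axis_None)
  \<comment> \<open>As q has level 0, orthogonality in \<open>form\<close> becomes orthogonality of
    the slopes under \<Sigma>, which is the hypothesis of \<open>reflect_inner\<close>.\<close>
  have ck: "slope (c k) \<bullet> (\<Sigma> *v slope q) = 0" if "k \<in> K" for k
  proof -
    have "form q (c k) = 0" using orth that by (simp add: signal_span_def span_base)
    then show ?thesis using lev form_sym by (simp add: form_def)
  qed
  obtain B where B [measurable]: "B \<in> sets (PiM K (\<lambda>_. borel))" and AB: "A = X -` B \<inter> space M"
    using A measurable_space[OF X] by (auto simp: sets_vimage_algebra2)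
  define \<phi> where "\<phi> y = indicator B (?Y y) * (q \<bullet> augment gbar y)" for y
  have Y [measurable]: "?Y \<in> borel \<rightarrow>\<^sub>M PiM K (\<lambda>_. borel)"
    unfolding inner_augment by measurable
  have \<phi> [measurable]: "\<phi> \<in> borel_measurable borel"
    unfolding \<phi>_def inner_augment[of q] by measurable
  have "?Y (reflect (slope q) y) = ?Y y" for y
    using ck by (auto simp: inner_augment inner_diff_right reflect_inner)
  then have refl: "\<phi> (reflect (slope q) y) = - \<phi> y" for y
    using reflect_inner_self[OF False] by (simp add: \<phi>_def inner_augment lev)
  have "(\<integral>x\<in>A. q \<bullet> gtilde x \<partial>M) = (\<integral>x. \<phi> (g x) \<partial>M)"
    unfolding set_lebesgue_integral_def
  proof (rule integral_cong_AE)
    show "AE x in M. indicator A x *\<^sub>R (q \<bullet> gtilde x) = \<phi> (g x)"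
      using AE_X by (rule AE_mp) (auto intro!: AE_I2 simp: AB \<phi>_def indicator_def)
    show "(\<lambda>x. indicator A x *\<^sub>R (q \<bullet> gtilde x)) \<in> borel_measurable M"
      unfolding AB inner_augment by measurable
  qed simp
  moreover have "(\<integral>x. \<phi> (g x) \<partial>M) = - (\<integral>x. \<phi> (g x) \<partial>M)"
    using expectation_reflect[OF False \<phi>] by (simp add: refl)
  ultimately show ?thesis by simp
qed

text \<open>The identity holds at every profile, not just almost surely, and f lives on the signal
  space, so f can serve as a strategy in the existence proof.\<close>

lemma affine_in_signals:
  assumes "p \<in> signal_span"
  shows "\<exists>f\<in>borel_measurable (PiM K (\<lambda>_. borel)). \<forall>y. f (\<lambda>k\<in>K. c k \<bullet> augment gbar y) = p \<bullet> augment gbar y"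
  using assms unfolding signal_span_def
proof (induction p rule: span_induct_alt)
  case base
  then show ?case by (intro bexI[of _ "\<lambda>_. 0"]) auto
next
  case (step r p q)
  then obtain f where f: "f \<in> borel_measurable (PiM K (\<lambda>_. borel))"
    "\<And>y. f (\<lambda>k\<in>K. c k \<bullet> augment gbar y) = q \<bullet> augment gbar y"
    by blast
  have "\<exists>h\<in>borel_measurable (PiM K (\<lambda>_. borel)).
      \<forall>y. h (\<lambda>k\<in>K. c k \<bullet> augment gbar y) = p \<bullet> augment gbar y"
  proof (cases "p = axis None 1")
    case True
    then show ?thesis by (intro bexI[of _ "\<lambda>_. gbar"]) (auto simp: inner_axis' augment_def)
  next
    case False
    with step obtain k where k: "k \<in> K" "p = c k" by auto
    then show ?thesis by (intro bexI[of _ "\<lambda>v. v k"]) auto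
  qed
  then obtain h where h: "h \<in> borel_measurable (PiM K (\<lambda>_. borel))"
    "\<And>y. h (\<lambda>k\<in>K. c k \<bullet> augment gbar y) = p \<bullet> augment gbar y"
    by blast
  show ?case
    using f h by (intro bexI[of _ "\<lambda>v. r * h v + f v"]) (auto simp: inner_add_left simp del: restrict_apply)
qed

lemma affine_signal_measurable:
  assumes "p \<in> signal_span"
  shows "\<exists>f\<in>borel_measurable signal_algebra. AE x in M. p \<bullet> gtilde x = f x"
proof -
  obtain f where f: "f \<in> borel_measurable (PiM K (\<lambda>_. borel))"
    "\<And>y. f (\<lambda>k\<in>K. c k \<bullet> augment gbar y) = p \<bullet> augment gbar y"
    using affine_in_signals[OF assms] by blast
  show ?thesis
  proof (intro bexI)
    show "AE x in M. p \<bullet> gtilde x = f (X x)"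
      using AE_X by eventually_elim (simp add: f(2))
    show "(\<lambda>x. f (X x)) \<in> borel_measurable signal_algebra"
      using measurable_compose[OF X_measurable f(1)] .
  qed
qed

text \<open>The two defining properties of a conditional expectation: p . gtilde is almost surely a
  function of the signals, and by orthogonality the remainder integrates to 0 over every event they
  decide.\<close>

lemma cond_expect_affine:
  assumes p: "p \<in> signal_span" and orth: "\<And>b. b \<in> signal_span \<Longrightarrow> form (a - p) b = 0"
  shows "AE x in M. cond_expect M (PiM K (\<lambda>_. borel)) X (\<lambda>x. a \<bullet> gtilde x) x = p \<bullet> gtilde x"
proof -
  obtain f where f: "f \<in> borel_measurable signal_algebra" "AE x in M. p \<bullet> gtilde x = f x"
    using affine_signal_measurable[OF p] by blast
  interpret S: finite_measure_subalgebra M signal_algebra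
    by unfold_locales (rule subalgebra)
  have [measurable]: "f \<in> borel_measurable M" using measurable_from_subalg[OF subalgebra f(1)] .
  have int: "integrable M (\<lambda>x. b \<bullet> gtilde x)" for b
    using square_integrable_affine by (rule integrable_if_square_integrable)
  note [measurable] = borel_measurable_integrable[OF int]
  have "AE x in M. real_cond_exp M signal_algebra (\<lambda>x. a \<bullet> gtilde x) x = f x"
  proof (rule S.real_cond_exp_charact)
    show "integrable M f" using int[of p] by (subst integrable_cong_AE[OF _ _ AE_symmetric[OF f(2)]]) auto
    fix A assume A: "A \<in> sets signal_algebra"
    then have AM: "A \<in> sets M" using subalgebra by (auto simp: subalgebra_def)
    have si: "set_integrable M A (\<lambda>x. b \<bullet> gtilde x)" for b
      using integrable_mult_indicator[OF AM int] by (simp add: set_integrable_def)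
    have "(\<integral>x\<in>A. (a - p) \<bullet> gtilde x \<partial>M) = 0" using set_integral_orthogonal[OF orth A] .
    then have "(\<integral>x\<in>A. a \<bullet> gtilde x \<partial>M) = (\<integral>x\<in>A. p \<bullet> gtilde x \<partial>M)"
      unfolding inner_diff_left using set_integral_diff(2)[OF si si] by simp
    also have "\<dots> = (\<integral>x\<in>A. f x \<partial>M)"
      using f(2) AM by (intro set_lebesgue_integral_cong_AE) auto
    finally show "(\<integral>x\<in>A. a \<bullet> gtilde x \<partial>M) = (\<integral>x\<in>A. f x \<partial>M)" .
  qed (use int f in auto)
  then show ?thesis unfolding cond_expect_def using f(2) by eventually_elim simp
qed

end

subsection \<open>First-order characterization of equilibria\<close>

lemma total_payoff_split:
  fixes l :: "'n::finite \<Rightarrow> real" and i :: 'n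
  defines "R \<equiv> \<Sum>j\<in>UNIV - {i}. l j"
  shows "total_payoff \<gamma> \<alpha> y l w =
    - (\<gamma> / real CARD('n)) * (l i + R) * (l i + R + w) + (y $ i * l i - \<alpha> * (l i)\<^sup>2) +
    (\<Sum>j\<in>UNIV - {i}. y $ j * l j - \<alpha> * (l j)\<^sup>2)"
proof -
  let ?L = "\<Sum>j\<in>UNIV. l j" and ?c = "\<gamma> / real CARD('n)"
  have L: "?L = l i + R" unfolding R_def by (rule sum.remove) auto
  have "total_payoff \<gamma> \<alpha> y l w = (\<Sum>j\<in>UNIV. l j * (- ?c * (?L + w)) + (y $ j * l j - \<alpha> * (l j)\<^sup>2))"
    unfolding total_payoff_def own_payoff_def by (intro sum.cong) (auto simp: algebra_simps)
  also have "\<dots> = ?L * (- ?c * (?L + w)) + (\<Sum>j\<in>UNIV. y $ j * l j - \<alpha> * (l j)\<^sup>2)"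
    by (simp only: sum.distrib sum_distrib_right[symmetric])
  also have "(\<Sum>j\<in>UNIV. y $ j * l j - \<alpha> * (l j)\<^sup>2) =
      (y $ i * l i - \<alpha> * (l i)\<^sup>2) + (\<Sum>j\<in>UNIV - {i}. y $ j * l j - \<alpha> * (l j)\<^sup>2)"
    by (rule sum.remove) auto
  finally show ?thesis
    unfolding L by (simp only: mult_ac add_ac)
qed

text \<open>The three behaviors enter the argument only through their constants from here on. For
  the altruistic payoff the cross coefficient doubles because own consumption also raises the cost
  of the others; in welfare the price terms cancel, which removes the noise and puts \<kappa> in
  place of \<gamma>.\<close>

lemma payoff_deviation:
  fixes l :: "'n::finite \<Rightarrow> real" and i :: 'n
  shows "payoff \<gamma> \<alpha> \<kappa> \<Gamma> y i (l(i := d)) w = payoff \<gamma> \<alpha> \<kappa> \<Gamma> y i l w +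
    (d - l i) * (y $ i - coeff_lambda \<Gamma> (real CARD('n)) \<gamma> \<kappa> * (\<Sum>j\<in>UNIV - {i}. l j)
      - coeff_mu \<Gamma> (real CARD('n)) \<gamma> \<kappa> * w) -
    (coeff_tau \<Gamma> (real CARD('n)) \<gamma> \<kappa> + \<alpha>) * (d\<^sup>2 - (l i)\<^sup>2)"
proof -
  define c k R C where "c = \<gamma> / real CARD('n)" and "k = \<kappa> / real CARD('n)"
    and "R = (\<Sum>j\<in>UNIV - {i}. l j)" and "C = (\<Sum>j\<in>UNIV - {i}. y $ j * l j - \<alpha> * (l j)\<^sup>2)"
  have ck: "2 * \<gamma> / real CARD('n) = 2 * c" "2 * \<kappa> / real CARD('n) = 2 * k" by (simp_all add: c_def k_def)
  have upd: "(\<Sum>j\<in>UNIV - {i}. f j ((l(i := d)) j)) = (\<Sum>j\<in>UNIV - {i}. f j (l j))" for f :: "'n \<Rightarrow> real \<Rightarrow> real"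
    by (intro sum.cong) auto
  have L: "(\<Sum>j\<in>UNIV. l j) = l i + R"
    unfolding R_def by (rule sum.remove) auto
  have Ld: "(\<Sum>j\<in>UNIV. (l(i := d)) j) = d + R"
    using sum.remove[of UNIV i "l(i := d)"] upd[of "\<lambda>_ v. v"] by (simp add: R_def)
  have T: "total_payoff \<gamma> \<alpha> y l w = - c * (l i + R) * (l i + R + w) + (y $ i * l i - \<alpha> * (l i)\<^sup>2) + C"
    unfolding total_payoff_split[where i = i] R_def C_def c_def ..
  have Td: "total_payoff \<gamma> \<alpha> y (l(i := d)) w = - c * (d + R) * (d + R + w) + (y $ i * d - \<alpha> * d\<^sup>2) + C"
    unfolding total_payoff_split[where i = i] upd[of "\<lambda>_ v. v"] upd[of "\<lambda>j v. y $ j * v - \<alpha> * v\<^sup>2"]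
      R_def C_def c_def by simp
  show ?thesis
    unfolding R_def[symmetric]
    by (cases \<Gamma>; simp only: payoff.simps coeff_lambda.simps coeff_mu.simps coeff_tau.simps
        own_payoff_def welfare_def Let_def L Ld T Td ck c_def[symmetric] k_def[symmetric] fun_upd_same;
      simp add: power2_eq_square algebra_simps)
qed

lemma info_measurable:
  fixes s :: "'n::finite profile"
  assumes "\<And>j t. 1 \<le> t \<Longrightarrow> t < h \<Longrightarrow> s j t \<in> borel_measurable (info_space \<Omega> E j t)"
  shows "info \<Omega> E s i h \<in> borel \<rightarrow>\<^sub>M info_space \<Omega> E i h"
  using assms
proof (induction h arbitrary: i rule: less_induct)
  case (less h)
  have c: "(\<lambda>y. consumption \<Omega> E s y t j) \<in> borel_measurable borel" if t: "1 \<le> t" "t < h" for j t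
  proof -
    have "info \<Omega> E s j t \<in> borel \<rightarrow>\<^sub>M info_space \<Omega> E j t"
      using less.prems t by (intro less.IH) (meson less_trans)+
    from measurable_compose[OF this less.prems[OF t]] show ?thesis
      by (simp only: consumption_eq)
  qed
  show ?case
    unfolding info_def
  proof (rule measurable_restrict)
    fix k assume k: "k \<in> observed \<Omega> E i h"
    show "(\<lambda>y. case k of Own_Preference \<Rightarrow> y $ i | Consumption_Of j t \<Rightarrow> consumption \<Omega> E s y t j
        | Total_Consumption t \<Rightarrow> \<Sum>j\<in>UNIV. consumption \<Omega> E s y t j) \<in> borel_measurable borel"
    proof (cases k)
      case (Consumption_Of j t)
      with k have "1 \<le> t" "t < h" by (cases \<Omega>; auto)+
      then show ?thesis using c Consumption_Of by simp
    next
      case (Total_Consumption t)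
      with k have "1 \<le> t" "t < h" by (cases \<Omega>; auto)+
      then show ?thesis using c Total_Consumption by (simp add: borel_measurable_sum)
    qed simp
  qed
qed

lemma finite_observed: "finite (observed \<Omega> E (i :: 'n::finite) h)"
proof -
  have "{Consumption_Of j t | j t. (i, j) \<in> E \<and> 1 \<le> t \<and> t < h} \<subseteq> case_prod Consumption_Of ` (UNIV \<times> {..<h})"
    by auto
  then have "finite {Consumption_Of j t | j t. (i, j) \<in> E \<and> 1 \<le> t \<and> t < h}"
    by (rule finite_subset) auto
  moreover have "finite {Total_Consumption t :: 'n signal | t. 1 \<le> t \<and> t < h}" by simp
  ultimately show ?thesis by (cases \<Omega>) auto
qed

text \<open>A linear term of either sign cannot stay below a quadratic one near 0. The choice
  \<open>e = a / (b + 1)\<close> replaces a limit; the added 1 keeps the denominator positive for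
  \<open>b = 0\<close>.\<close>

lemma eq_0_if_dominated_quadratically:
  fixes a b :: real
  assumes "\<And>e. e * a \<le> e\<^sup>2 * b" and "0 \<le> b"
  shows "a = 0"
proof (rule ccontr)
  assume "a \<noteq> 0"
  then have "0 < a\<^sup>2" by simp
  have "a\<^sup>2 * (b + 1) = (a / (b + 1) * a) * (b + 1)\<^sup>2"
    using \<open>0 \<le> b\<close> by (simp add: power2_eq_square)
  also have "\<dots> \<le> ((a / (b + 1))\<^sup>2 * b) * (b + 1)\<^sup>2"
    by (rule mult_right_mono[OF assms(1)]) simp
  also have "\<dots> = a\<^sup>2 * b"
    using \<open>0 \<le> b\<close> by (simp add: power_divide)
  finally show False using \<open>0 < a\<^sup>2\<close> by (simp add: algebra_simps)
qed

locale consumption_game = normal_prior M g gbar \<Sigma>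
  for M :: "'a measure" and g :: "'a \<Rightarrow> real^'n::finite" and gbar \<Sigma> +
  fixes \<omega> :: "nat \<Rightarrow> 'a \<Rightarrow> real" and \<omega>bar \<gamma> \<alpha> \<kappa> :: "nat \<Rightarrow> real"
    and E :: "('n \<times> 'n) set" and H :: nat and \<Gamma> :: behavior and \<Omega> :: info_model
  assumes params: "\<And>h. h \<in> {1..H} \<Longrightarrow> \<gamma> h > 0 \<and> \<alpha> h > 0 \<and> \<kappa> h > 0"
    and \<omega>_mean: "\<And>h. h \<in> {1..H} \<Longrightarrow> integrable M (\<omega> h) \<and> integral\<^sup>L M (\<omega> h) = \<omega>bar h"
    and \<omega>_indep: "\<And>h. h \<in> {1..H} \<Longrightarrow> prob_space.indep_set M
           {\<omega> h -` A \<inter> space M | A. A \<in> sets borel} {g -` B \<inter> space M | B. B \<in> sets borel}"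
begin

definition lam :: "nat \<Rightarrow> real" where
  "lam h = coeff_lambda \<Gamma> (real CARD('n)) (\<gamma> h) (\<kappa> h)"

definition mu :: "nat \<Rightarrow> real" where
  "mu h = coeff_mu \<Gamma> (real CARD('n)) (\<gamma> h) (\<kappa> h)"

definition rho :: "nat \<Rightarrow> real" where
  "rho h = coeff_rho \<Gamma> (real CARD('n)) (\<gamma> h) (\<kappa> h) (\<alpha> h)"

text \<open>Minus the second derivative of the payoff in the own action, and the reciprocal of
  \<open>rho\<close>.\<close>

definition curv :: "nat \<Rightarrow> real" where
  "curv h = 2 * (coeff_tau \<Gamma> (real CARD('n)) (\<gamma> h) (\<kappa> h) + \<alpha> h)"

lemma rho_eq: "rho h = 1 / curv h"
  by (simp add: rho_def coeff_rho_def curv_def inverse_eq_divide)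

lemma lam_nonneg: "h \<in> {1..H} \<Longrightarrow> 0 \<le> lam h"
  using params[of h] unfolding lam_def by (cases \<Gamma>) auto

text \<open>For the altruistic and welfare payoffs \<open>lam\<close> equals twice the
  \<tau>-constant, so the strict inequality rests on \<open>\<alpha> h > 0\<close> alone.\<close>

lemma lam_less_curv: "h \<in> {1..H} \<Longrightarrow> lam h < curv h"
  using params[of h] unfolding lam_def curv_def by (cases \<Gamma>) (auto simp: field_simps add_pos_pos)

lemma curv_pos: "h \<in> {1..H} \<Longrightarrow> 0 < curv h"
  using lam_nonneg[of h] lam_less_curv[of h] by simp

text \<open>Independence lets the noise be replaced by its mean against any integrable function of
  the preferences. It also supplies integrability of the product, so first moments of the noise
  suffice.\<close>

lemma indep_product:
  fixes \<phi> :: "real^'n \<Rightarrow> real"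
  assumes h: "h \<in> {1..H}" and [measurable]: "\<phi> \<in> borel_measurable borel" and int: "integrable M (\<lambda>x. \<phi> (g x))"
  shows "integrable M (\<lambda>x. \<phi> (g x) * \<omega> h x)"
    and "(\<integral>x. \<phi> (g x) * \<omega> h x \<partial>M) = (\<integral>x. \<phi> (g x) \<partial>M) * \<omega>bar h"
proof -
  have [measurable]: "\<omega> h \<in> borel_measurable M" using \<omega>_mean[OF h] by auto
  have stable: "Int_stable {f -` A \<inter> space M | A. A \<in> sets borel}" for f :: "'a \<Rightarrow> real"
  proof (rule Int_stableI)
    fix a b assume "a \<in> {f -` A \<inter> space M | A. A \<in> sets borel}" "b \<in> {f -` A \<inter> space M | A. A \<in> sets borel}"
    then obtain A B where "A \<in> sets borel" "B \<in> sets borel" "a = f -` A \<inter> space M" "b = f -` B \<inter> space M"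
      by blast
    then have "a \<inter> b = f -` (A \<inter> B) \<inter> space M" "A \<inter> B \<in> sets borel" by auto
    then show "a \<inter> b \<in> {f -` A \<inter> space M | A. A \<in> sets borel}" by blast
  qed
  have "indep_var borel (\<phi> \<circ> g) borel (\<omega> h)"
    unfolding indep_var_eq
  proof (intro conjI indep_set_sigma_sets stable)
    show "indep_set {(\<phi> \<circ> g) -` A \<inter> space M | A. A \<in> sets borel} {\<omega> h -` A \<inter> space M | A. A \<in> sets borel}"
    proof (rule indep_setI)
      fix a b assume "a \<in> {(\<phi> \<circ> g) -` A \<inter> space M | A. A \<in> sets borel}" "b \<in> {\<omega> h -` A \<inter> space M | A. A \<in> sets borel}"
      then obtain A B where A: "A \<in> sets borel" "a = (\<phi> \<circ> g) -` A \<inter> space M"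
        and B: "B \<in> sets borel" "b = \<omega> h -` B \<inter> space M" by blast
      have "a = g -` (\<phi> -` A) \<inter> space M" using A by auto
      moreover have "\<phi> -` A \<in> sets borel" using measurable_sets[OF assms(2) A(1)] by simp
      ultimately have a: "a \<in> {g -` B \<inter> space M | B. B \<in> sets borel}" by blast
      have b: "b \<in> {\<omega> h -` A \<inter> space M | A. A \<in> sets borel}" using B by blast
      show "prob (a \<inter> b) = prob a * prob b"
        using indep_setD[OF \<omega>_indep[OF h] b a] by (simp add: Int_commute mult.commute)
    qed auto
  qed auto
  then show "integrable M (\<lambda>x. \<phi> (g x) * \<omega> h x)"
    "(\<integral>x. \<phi> (g x) * \<omega> h x \<partial>M) = (\<integral>x. \<phi> (g x) \<partial>M) * \<omega>bar h"
    using indep_var_integrable[of "\<phi> \<circ> g" "\<omega> h"] indep_var_lebesgue_integral[of "\<phi> \<circ> g" "\<omega> h"]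
      int \<omega>_mean[OF h] by (auto simp: comp_def)
qed

definition info_of :: "'n profile \<Rightarrow> 'n \<Rightarrow> nat \<Rightarrow> 'a \<Rightarrow> 'n signal \<Rightarrow> real" where
  "info_of s i h x = info \<Omega> E s i h (g x)"

definition action :: "'n profile \<Rightarrow> 'n \<Rightarrow> nat \<Rightarrow> 'a \<Rightarrow> real" where
  "action s i h x = s i h (info_of s i h x)"

abbreviation info_algebra :: "'n profile \<Rightarrow> 'n \<Rightarrow> nat \<Rightarrow> 'a measure" where
  "info_algebra s i h \<equiv> vimage_algebra (space M) (info_of s i h) (info_space \<Omega> E i h)"

definition strategy_profile :: "'n profile \<Rightarrow> bool" where
  "strategy_profile s \<longleftrightarrow> (\<forall>i. \<forall>h\<in>{1..H}. is_strategy M (info_space \<Omega> E i h) (info_of s i h) (s i h))"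

text \<open>Conditional expectation of the negated marginal payoff equal to 0, expressed on events:
  this is linear in the actions and avoids choosing versions. The noise is already replaced by its
  mean.\<close>

definition first_order :: "'n profile \<Rightarrow> 'n \<Rightarrow> nat \<Rightarrow> bool" where
  "first_order s i h \<longleftrightarrow> (\<forall>A\<in>sets (info_algebra s i h).
     (\<integral>x\<in>A. curv h * action s i h x + lam h * (\<Sum>j\<in>UNIV - {i}. action s j h x)
        - g x $ i + mu h * \<omega>bar h \<partial>M) = 0)"

abbreviation equilibrium :: "'n profile \<Rightarrow> bool" where
  "equilibrium \<equiv> bayes_nash M g \<omega> \<gamma> \<alpha> \<kappa> \<Gamma> \<Omega> E {1..H}"

abbreviation realized_payoff :: "nat \<Rightarrow> 'n \<Rightarrow> ('n \<Rightarrow> 'a \<Rightarrow> real) \<Rightarrow> 'a \<Rightarrow> real" where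
  "realized_payoff h i l x \<equiv> payoff (\<gamma> h) (\<alpha> h) (\<kappa> h) \<Gamma> (g x) i (\<lambda>j. l j x) (\<omega> h x)"

lemma equilibrium_iff:
  "equilibrium s \<longleftrightarrow> strategy_profile s \<and>
    (\<forall>i. \<forall>h\<in>{1..H}. \<forall>d. is_strategy M (info_space \<Omega> E i h) (info_of s i h) d \<longrightarrow>
      (AE x in M. real_cond_exp M (info_algebra s i h)
          (realized_payoff h i ((\<lambda>j. action s j h)(i := \<lambda>x. d (info_of s i h x)))) x
        \<le> real_cond_exp M (info_algebra s i h) (realized_payoff h i (\<lambda>j. action s j h)) x))"
proof -
  have upd: "(\<lambda>j. ((\<lambda>j. action s j h)(i := \<lambda>x. d (info_of s i h x))) j x) =
      (\<lambda>j. s j h (info \<Omega> E s j h (g x)))(i := d (info \<Omega> E s i h (g x)))" for i h d x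
    by (auto simp: fun_eq_iff action_def info_of_def)
  show ?thesis
    unfolding bayes_nash_def strategy_profile_def cond_expect_def upd
    unfolding action_def[abs_def] info_of_def[abs_def] by (rule refl)
qed

lemma info_of_measurable:
  assumes "strategy_profile s" "h \<in> {1..H}"
  shows "info \<Omega> E s i h \<in> borel \<rightarrow>\<^sub>M info_space \<Omega> E i h" "info_of s i h \<in> M \<rightarrow>\<^sub>M info_space \<Omega> E i h"
proof -
  show "info \<Omega> E s i h \<in> borel \<rightarrow>\<^sub>M info_space \<Omega> E i h"
    using assms by (intro info_measurable) (auto simp: strategy_profile_def is_strategy_def)
  then show "info_of s i h \<in> M \<rightarrow>\<^sub>M info_space \<Omega> E i h"
    unfolding info_of_def[abs_def] by (rule measurable_compose[OF g_measurable])
qed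

lemma info_subalgebra:
  assumes "strategy_profile s" "h \<in> {1..H}"
  shows "subalgebra M (info_algebra s i h)"
    "info_of s i h \<in> info_algebra s i h \<rightarrow>\<^sub>M info_space \<Omega> E i h"
proof -
  note X = info_of_measurable(2)[OF assms, of i]
  show "subalgebra M (info_algebra s i h)"
    using measurable_space[OF X] measurable_sets[OF X] by (auto simp: subalgebra_def sets_vimage_algebra2)
  show "info_of s i h \<in> info_algebra s i h \<rightarrow>\<^sub>M info_space \<Omega> E i h"
    using measurable_space[OF X] by (intro measurable_vimage_algebra1) blast
qed

lemma strategy_square_integrable:
  assumes s: "strategy_profile s" "h \<in> {1..H}"
    and d: "is_strategy M (info_space \<Omega> E i h) (info_of s i h) d"
  shows "square_integrable M (\<lambda>x. d (info_of s i h x))"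
    and "integrable M (\<lambda>x. d (info_of s i h x) * \<omega> h x)"
proof -
  have dm: "d \<in> borel_measurable (info_space \<Omega> E i h)" using d by (simp add: is_strategy_def)
  show sq: "square_integrable M (\<lambda>x. d (info_of s i h x))"
    using d measurable_compose[OF info_of_measurable(2)[OF s] dm]
    by (simp add: square_integrable_def is_strategy_def)
  show "integrable M (\<lambda>x. d (info_of s i h x) * \<omega> h x)"
    using indep_product(1)[OF s(2) measurable_compose[OF info_of_measurable(1)[OF s] dm]]
      integrable_if_square_integrable[OF sq] by (simp add: info_of_def)
qed

lemma action_square_integrable:
  assumes "strategy_profile s" "h \<in> {1..H}"
  shows "square_integrable M (action s i h)" "integrable M (\<lambda>x. action s i h x * \<omega> h x)"
  using strategy_square_integrable[OF assms, of i "s i h"] assms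
  by (simp_all add: strategy_profile_def action_def[abs_def])

lemma preference_square_integrable: "square_integrable M (\<lambda>x. g x $ i)"
  using square_integrable_affine[of "axis (Some i) 1"] by (simp add: inner_axis' augment_def)

lemma payoff_integrable:
  assumes h: "h \<in> {1..H}" and l: "\<And>j. square_integrable M (l j)" "\<And>j. integrable M (\<lambda>x. l j x * \<omega> h x)"
  shows "integrable M (realized_payoff h i l)"
proof -
  let ?c = "\<gamma> h / real CARD('n)" and ?L = "\<lambda>x. \<Sum>j\<in>UNIV. l j x"
  have L: "square_integrable M ?L" by (intro square_integrable_sum l)
  have own: "integrable M (\<lambda>x. own_payoff (\<gamma> h) (\<alpha> h) (g x) j (\<lambda>j. l j x) (\<omega> h x))" for j
  proof -
    have "own_payoff (\<gamma> h) (\<alpha> h) (g x) j (\<lambda>j. l j x) (\<omega> h x) =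
        - ?c * (l j x * ?L x) - ?c * (l j x * \<omega> h x) + g x $ j * l j x - \<alpha> h * (l j x * l j x)" for x
      by (simp add: own_payoff_def algebra_simps power2_eq_square add_divide_distrib)
    then show ?thesis
      by (simp only:) (intro Bochner_Integration.integrable_diff Bochner_Integration.integrable_add
        integrable_mult_right square_integrable_mult l L preference_square_integrable)
  qed
  then have total: "integrable M (\<lambda>x. total_payoff (\<gamma> h) (\<alpha> h) (g x) (\<lambda>j. l j x) (\<omega> h x))"
    unfolding total_payoff_def by (intro Bochner_Integration.integrable_sum)
  have L\<omega>: "integrable M (\<lambda>x. ?L x * \<omega> h x)"
    unfolding sum_distrib_right by (intro Bochner_Integration.integrable_sum l)
  have "welfare (\<gamma> h) (\<alpha> h) (\<kappa> h) (g x) (\<lambda>j. l j x) (\<omega> h x) =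
      total_payoff (\<gamma> h) (\<alpha> h) (g x) (\<lambda>j. l j x) (\<omega> h x) + ?c * (?L x * ?L x) + ?c * (?L x * \<omega> h x)
      - (\<kappa> h / real CARD('n)) * (?L x * ?L x)" for x
    by (simp add: welfare_def Let_def algebra_simps power2_eq_square add_divide_distrib)
  then have "integrable M (\<lambda>x. welfare (\<gamma> h) (\<alpha> h) (\<kappa> h) (g x) (\<lambda>j. l j x) (\<omega> h x))"
    by (simp only:) (intro Bochner_Integration.integrable_diff Bochner_Integration.integrable_add
        integrable_mult_right square_integrable_mult total L\<omega> L)
  with own total show ?thesis by (cases \<Gamma>) simp_all
qed

text \<open>The derivative of the realized payoff in the own action, at the actions played and with
  the noise still present.\<close>

definition marginal :: "'n profile \<Rightarrow> 'n \<Rightarrow> nat \<Rightarrow> 'a \<Rightarrow> real" where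
  "marginal s i h x = g x $ i - lam h * (\<Sum>j\<in>UNIV - {i}. action s j h x) - mu h * \<omega> h x
     - curv h * action s i h x"

text \<open>The Taylor expansion about the played action, exact because the payoff is
  quadratic.\<close>

lemma realized_payoff_deviation:
  "realized_payoff h i ((\<lambda>j. action s j h)(i := d)) x =
    realized_payoff h i (\<lambda>j. action s j h) x + (d x - action s i h x) * marginal s i h x
      - curv h / 2 * (d x - action s i h x)\<^sup>2"
proof -
  have "(\<lambda>j. ((\<lambda>j. action s j h)(i := d)) j x) = (\<lambda>j. action s j h x)(i := d x)" by auto
  then show ?thesis
    by (simp only: payoff_deviation) (simp add: marginal_def lam_def mu_def curv_def power2_eq_square field_simps)
qed

lemma marginal_integrable:
  assumes s: "strategy_profile s" "h \<in> {1..H}"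
    and d: "is_strategy M (info_space \<Omega> E i h) (info_of s i h) d"
  shows "integrable M (\<lambda>x. d (info_of s i h x) * marginal s i h x)" "integrable M (marginal s i h)"
proof -
  have *: "integrable M (\<lambda>x. d (info_of s i h x) * marginal s i h x)"
    if d: "is_strategy M (info_space \<Omega> E i h) (info_of s i h) d" for d
  proof -
    let ?d = "\<lambda>x. d (info_of s i h x)"
    have "?d x * marginal s i h x = ?d x * g x $ i - lam h * (?d x * (\<Sum>j\<in>UNIV - {i}. action s j h x))
        - mu h * (?d x * \<omega> h x) - curv h * (?d x * action s i h x)" for x
      by (simp add: marginal_def algebra_simps)
    then show ?thesis
      by (simp only:) (intro Bochner_Integration.integrable_diff integrable_mult_right square_integrable_mult
        strategy_square_integrable[OF s d] action_square_integrable[OF s] preference_square_integrable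
        square_integrable_sum)
  qed
  show "integrable M (\<lambda>x. d (info_of s i h x) * marginal s i h x)" using * d .
  show "integrable M (marginal s i h)" using *[of "\<lambda>_. 1"] by (simp add: is_strategy_def)
qed

text \<open>Information is a function of the preferences, so each of its events is independent of
  the noise and sees only the mean of the noise.\<close>

lemma set_integral_marginal:
  assumes s: "strategy_profile s" "h \<in> {1..H}" and A: "A \<in> sets (info_algebra s i h)"
  shows "(\<integral>x\<in>A. marginal s i h x \<partial>M) =
    - (\<integral>x\<in>A. curv h * action s i h x + lam h * (\<Sum>j\<in>UNIV - {i}. action s j h x)
        - g x $ i + mu h * \<omega>bar h \<partial>M)"
proof -
  let ?R = "\<lambda>x. curv h * action s i h x + lam h * (\<Sum>j\<in>UNIV - {i}. action s j h x) - g x $ i"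
  have AM [measurable]: "A \<in> sets M" using info_subalgebra(1)[OF s] A by (auto simp: subalgebra_def)
  obtain B where B: "B \<in> sets (info_space \<Omega> E i h)" and AB: "A = info_of s i h -` B \<inter> space M"
    using A measurable_space[OF info_of_measurable(2)[OF s]] by (auto simp: sets_vimage_algebra2)
  have "square_integrable M ?R"
    by (intro square_integrable_diff square_integrable_add square_integrable_cmult square_integrable_sum
      action_square_integrable[OF s] preference_square_integrable)
  then have R: "integrable M ?R" by (rule integrable_if_square_integrable)
  have W: "integrable M (\<omega> h)" using \<omega>_mean[OF s(2)] by simp
  have si: "set_integrable M A ?R" "set_integrable M A (\<lambda>x. mu h * \<omega> h x)" "set_integrable M A (\<lambda>x. mu h * \<omega>bar h)"
    unfolding set_integrable_def
    by (intro integrable_mult_indicator AM R integrable_mult_right W integrable_const)+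
  have ind: "indicator A x = (indicator (info \<Omega> E s i h -` B) (g x) :: real)" if "x \<in> space M" for x
    using that by (auto simp: AB info_of_def indicator_def)
  have BB: "info \<Omega> E s i h -` B \<in> sets borel"
    using measurable_sets[OF info_of_measurable(1)[OF s] B] by simp
  have "(\<integral>x\<in>A. \<omega> h x \<partial>M) = (\<integral>x. indicator (info \<Omega> E s i h -` B) (g x) * \<omega> h x \<partial>M)"
    unfolding set_lebesgue_integral_def using ind by (intro Bochner_Integration.integral_cong) auto
  also have "\<dots> = (\<integral>x. indicator (info \<Omega> E s i h -` B) (g x) \<partial>M) * \<omega>bar h"
  proof (rule indep_product(2)[OF s(2)])
    have "integrable M (indicator A :: 'a \<Rightarrow> real)" by (simp add: less_top[symmetric])
    then show "integrable M (\<lambda>x. indicator (info \<Omega> E s i h -` B) (g x) :: real)"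
      by (subst (asm) Bochner_Integration.integrable_cong[OF refl ind]) auto
  qed (use BB in simp)
  also have "\<dots> = (\<integral>x. indicator A x \<partial>M) * \<omega>bar h"
    using ind by (intro arg_cong2[where f="(*)"] Bochner_Integration.integral_cong) auto
  also have "\<dots> = (\<integral>x\<in>A. \<omega>bar h \<partial>M)"
    unfolding set_lebesgue_integral_def by simp
  finally have "(\<integral>x\<in>A. mu h * \<omega> h x \<partial>M) = (\<integral>x\<in>A. mu h * \<omega>bar h \<partial>M)"
    by (simp only: set_integral_mult_right)
  moreover have "(\<integral>x\<in>A. marginal s i h x \<partial>M) = - (\<integral>x\<in>A. ?R x + mu h * \<omega> h x \<partial>M)"
    unfolding set_lebesgue_integral_def integral_minus[symmetric]
    by (intro Bochner_Integration.integral_cong) (simp_all add: marginal_def algebra_simps)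
  ultimately show ?thesis
    using set_integral_add(2)[OF si(1,2)] set_integral_add(2)[OF si(1,3)] by simp
qed

lemma deviation_payoff_integrable:
  assumes s: "strategy_profile s" "h \<in> {1..H}"
    and d: "is_strategy M (info_space \<Omega> E i h) (info_of s i h) d"
  shows "integrable M (realized_payoff h i ((\<lambda>j. action s j h)(i := \<lambda>x. d (info_of s i h x))))"
    "integrable M (realized_payoff h i (\<lambda>j. action s j h))"
  using strategy_square_integrable[OF s d] action_square_integrable[OF s]
  by (intro payoff_integrable[OF s(2)]; simp)+

lemma equilibrium_first_order:
  assumes eq: "equilibrium s" and h: "h \<in> {1..H}"
  shows "first_order s i h"
  unfolding first_order_def
proof
  have sp: "strategy_profile s" using eq unfolding equilibrium_iff by blast
  note s = sp h
  interpret S: finite_measure_subalgebra M "info_algebra s i h"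
    by unfold_locales (rule info_subalgebra(1)[OF s])
  fix A assume A: "A \<in> sets (info_algebra s i h)"
  then have AM [measurable]: "A \<in> sets M" using info_subalgebra(1)[OF s] by (auto simp: subalgebra_def)
  obtain B where B [measurable]: "B \<in> sets (info_space \<Omega> E i h)" and AB: "A = info_of s i h -` B \<inter> space M"
    using A measurable_space[OF info_of_measurable(2)[OF s]] by (auto simp: sets_vimage_algebra2)
  have ind: "indicator B (info_of s i h x) = (indicator A x :: real)" if "x \<in> space M" for x
    using that by (auto simp: AB indicator_def)
  have si: "is_strategy M (info_space \<Omega> E i h) (info_of s i h) (s i h)"
    using sp h unfolding strategy_profile_def by blast
  then have sm: "s i h \<in> borel_measurable (info_space \<Omega> E i h)"
    by (simp add: is_strategy_def)
  have m: "integrable M (\<lambda>x. indicator A x * marginal s i h x)"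
    using integrable_real_mult_indicator[OF AM marginal_integrable(2)[OF s si]] by (simp add: mult.commute)
  have "e * (\<integral>x\<in>A. marginal s i h x \<partial>M) \<le> e\<^sup>2 * (curv h / 2 * measure M A)" for e
  proof -
    \<comment> \<open>The action is shifted by a constant on one event and kept elsewhere. This is
      an admissible deviation because the event is the preimage of a measurable set \<open>B\<close>
      of information values.\<close>
    define d where "d v = s i h v + e * indicator B v" for v
    have dA: "d (info_of s i h x) = action s i h x + e * indicator A x" if "x \<in> space M" for x
      using ind[OF that] by (simp add: d_def action_def)
    have dst: "is_strategy M (info_space \<Omega> E i h) (info_of s i h) d"
    proof -
      have "square_integrable M (\<lambda>x. action s i h x + e * indicator A x)"
        by (intro square_integrable_add square_integrable_cmult action_square_integrable[OF s] square_integrable_indicator AM)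
      then have "integrable M (\<lambda>x. (action s i h x + e * indicator A x)\<^sup>2)"
        by (simp add: square_integrable_def)
      then have "integrable M (\<lambda>x. (d (info_of s i h x))\<^sup>2)"
        by (subst Bochner_Integration.integrable_cong[OF refl]) (auto simp: dA)
      moreover have "d \<in> borel_measurable (info_space \<Omega> E i h)"
        unfolding d_def using sm by measurable
      ultimately show ?thesis by (simp add: is_strategy_def)
    qed
    let ?P = "realized_payoff h i (\<lambda>j. action s j h)"
    let ?Q = "realized_payoff h i ((\<lambda>j. action s j h)(i := \<lambda>x. d (info_of s i h x)))"
    note ints = deviation_payoff_integrable[OF s dst]
    have "AE x in M. real_cond_exp M (info_algebra s i h) ?Q x \<le> real_cond_exp M (info_algebra s i h) ?P x"
      using eq h dst unfolding equilibrium_iff by blast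
    then have "(\<integral>x. ?Q x \<partial>M) \<le> (\<integral>x. ?P x \<partial>M)"
      using integral_mono_AE[OF S.real_cond_exp_int(1)[OF ints(1)] S.real_cond_exp_int(1)[OF ints(2)]]
        S.real_cond_exp_int(2)[OF ints(1)] S.real_cond_exp_int(2)[OF ints(2)] by simp
    also have "(\<integral>x. ?Q x \<partial>M) =
        (\<integral>x. ?P x + e * (indicator A x * marginal s i h x) - e\<^sup>2 * (curv h / 2) * indicator A x \<partial>M)"
    proof (rule Bochner_Integration.integral_cong[OF refl])
      fix x assume x: "x \<in> space M"
      show "?Q x = ?P x + e * (indicator A x * marginal s i h x) - e\<^sup>2 * (curv h / 2) * indicator A x"
        unfolding realized_payoff_deviation dA[OF x] by (simp add: indicator_def)
    qed
    also have "\<dots> = (\<integral>x. ?P x \<partial>M) + e * (\<integral>x. indicator A x * marginal s i h x \<partial>M) - e\<^sup>2 * (curv h / 2) * measure M A"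
      using ints m by (simp add: less_top[symmetric])
    finally show ?thesis by (simp add: set_lebesgue_integral_def)
  qed
  then have "(\<integral>x\<in>A. marginal s i h x \<partial>M) = 0"
    by (rule eq_0_if_dominated_quadratically) (simp add: less_imp_le[OF curv_pos[OF h]])
  then show "(\<integral>x\<in>A. curv h * action s i h x + lam h * (\<Sum>j\<in>UNIV - {i}. action s j h x)
        - g x $ i + mu h * \<omega>bar h \<partial>M) = 0"
    using set_integral_marginal[OF s A] by simp
qed

text \<open>The size of a deviation is known to the consumer and factors out of the conditional
  expectation, leaving the conditional mean of the marginal, which is 0. Only the nonpositive
  quadratic term of the expansion survives.\<close>

lemma equilibrium_if_first_order:
  assumes sp: "strategy_profile s" and fo: "\<And>i h. h \<in> {1..H} \<Longrightarrow> first_order s i h"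
  shows "equilibrium s"
  unfolding equilibrium_iff
proof (intro conjI allI ballI impI sp)
  fix i h d assume h: "h \<in> {1..H}" and d: "is_strategy M (info_space \<Omega> E i h) (info_of s i h) d"
  note s = sp h
  interpret S: finite_measure_subalgebra M "info_algebra s i h"
    by unfold_locales (rule info_subalgebra(1)[OF s])
  let ?P = "realized_payoff h i (\<lambda>j. action s j h)"
  let ?Q = "realized_payoff h i ((\<lambda>j. action s j h)(i := \<lambda>x. d (info_of s i h x)))"
  let ?E = "real_cond_exp M (info_algebra s i h)"
  let ?f = "\<lambda>x. d (info_of s i h x) - action s i h x" and ?m = "marginal s i h"
  have si: "is_strategy M (info_space \<Omega> E i h) (info_of s i h) (s i h)"
    using sp h unfolding strategy_profile_def by blast
  note ints = deviation_payoff_integrable[OF s d]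
  have fm: "integrable M (\<lambda>x. ?f x * ?m x)"
    using Bochner_Integration.integrable_diff[OF marginal_integrable(1)[OF s d] marginal_integrable(1)[OF s si]]
    by (simp add: action_def left_diff_distrib)
  have m: "integrable M ?m" using marginal_integrable(2)[OF s d] .
  have fF: "?f \<in> borel_measurable (info_algebra s i h)"
    using d si measurable_compose[OF info_subalgebra(2)[OF s]]
    by (auto simp: action_def is_strategy_def intro!: borel_measurable_diff)
  have "AE x in M. ?E ?m x = 0"
  proof (rule S.real_cond_exp_charact)
    fix A assume "A \<in> sets (info_algebra s i h)"
    then show "(\<integral>x\<in>A. ?m x \<partial>M) = (\<integral>x\<in>A. 0 \<partial>M)"
      using set_integral_marginal[OF s] fo[OF h, of i] by (simp add: first_order_def)
  qed (use m in auto)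
  moreover have "AE x in M. ?E (\<lambda>x. ?f x * ?m x) x = ?f x * ?E ?m x"
    using fF m fm by (intro S.real_cond_exp_mult) auto
  moreover have "AE x in M. ?E (\<lambda>x. ?P x + ?f x * ?m x) x = ?E ?P x + ?E (\<lambda>x. ?f x * ?m x) x"
    using ints fm by (intro S.real_cond_exp_add)
  moreover have "AE x in M. ?E ?Q x \<le> ?E (\<lambda>x. ?P x + ?f x * ?m x) x"
  proof (rule S.real_cond_exp_mono)
    show "AE x in M. ?Q x \<le> ?P x + ?f x * ?m x"
      using curv_pos[OF h] unfolding realized_payoff_deviation by (intro AE_I2) simp
  qed (use ints fm in auto)
  ultimately show "AE x in M. ?E ?Q x \<le> ?E ?P x"
    by eventually_elim simp
qed

end

subsection \<open>Strategy coefficients\<close>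

context consumption_game
begin

definition signal_coeff :: "(nat \<Rightarrow> 'n \<Rightarrow> real^('n option)) \<Rightarrow> 'n \<Rightarrow> 'n signal \<Rightarrow> real^('n option)" where
  "signal_coeff a i k = (case k of
      Own_Preference \<Rightarrow> axis (Some i) 1
    | Consumption_Of j t \<Rightarrow> a t j
    | Total_Consumption t \<Rightarrow> \<Sum>j\<in>UNIV. a t j)"

definition observed_span :: "(nat \<Rightarrow> 'n \<Rightarrow> real^('n option)) \<Rightarrow> 'n \<Rightarrow> nat \<Rightarrow> (real^('n option)) set" where
  "observed_span a i h = span (insert (axis None 1) (signal_coeff a i ` observed \<Omega> E i h))"

text \<open>The coefficient vector of the integrand in \<open>first_order\<close> when the actions
  have coefficients b. The constant term is divided by \<open>gbar\<close> because
  \<open>axis None 1\<close> evaluates to \<open>gbar\<close>.\<close>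

definition residual :: "nat \<Rightarrow> ('n \<Rightarrow> real^('n option)) \<Rightarrow> 'n \<Rightarrow> real^('n option)" where
  "residual h b i = curv h *\<^sub>R b i + lam h *\<^sub>R (\<Sum>j\<in>UNIV - {i}. b j) - axis (Some i) 1
     + (mu h * \<omega>bar h / gbar) *\<^sub>R axis None 1"

definition coeff_first_order ::
  "(nat \<Rightarrow> 'n \<Rightarrow> real^('n option)) \<Rightarrow> nat \<Rightarrow> ('n \<Rightarrow> real^('n option)) \<Rightarrow> bool" where
  "coeff_first_order a h b \<longleftrightarrow>
     (\<forall>i. b i \<in> observed_span a i h \<and> (\<forall>c\<in>observed_span a i h. form (residual h b i) c = 0))"

text \<open>The transpose of T is the \<open>form\<close>-orthogonal projection onto what consumer i
  observes. No profile enters, only the coefficients of past actions.\<close>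

definition estimator :: "real^('n option)^('n option) \<Rightarrow> (nat \<Rightarrow> 'n \<Rightarrow> real^('n option)) \<Rightarrow> 'n \<Rightarrow> nat \<Rightarrow> bool" where
  "estimator T a i h \<longleftrightarrow> (\<forall>v. transpose T *v v \<in> observed_span a i h \<and>
     (\<forall>c\<in>observed_span a i h. form (v - transpose T *v v) c = 0))"

definition coeff_equations ::
  "('n \<Rightarrow> real^('n option)^('n option)) \<Rightarrow> nat \<Rightarrow> ('n \<Rightarrow> real^('n option)) \<Rightarrow> ('n \<Rightarrow> real) \<Rightarrow> bool" where
  "coeff_equations T h v r \<longleftrightarrow>
     (\<forall>i. transpose (T i) *v v i
        + (rho h * lam h) *\<^sub>R (\<Sum>j\<in>UNIV - {i}. (transpose (T i) ** transpose (T j)) *v v j)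
        = rho h *\<^sub>R axis (Some i) 1) \<and>
     (\<forall>i. r i + rho h * lam h * (\<Sum>j\<in>UNIV - {i}. r j) = - rho h * mu h * \<omega>bar h)"

lemma subspace_observed_span: "subspace (observed_span a i h)"
  by (simp add: observed_span_def)

lemma axis_None_observed: "axis None 1 \<in> observed_span a i h"
  by (simp add: observed_span_def span_base)

lemma own_preference_observed: "axis (Some i) 1 \<in> observed_span a i h"
proof -
  have "Own_Preference \<in> observed \<Omega> E i h" by (cases \<Omega>) auto
  then have "axis (Some i) 1 \<in> signal_coeff a i ` observed \<Omega> E i h"
    by (rule rev_image_eqI) (simp add: signal_coeff_def)
  then show ?thesis by (simp add: observed_span_def span_base)
qed

lemma axis_None_inner: "axis None 1 \<bullet> augment gbar y = gbar"
  by (simp add: inner_axis' augment_def)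

lemma axis_Some_inner: "axis (Some i) 1 \<bullet> augment gbar y = y $ i"
  by (simp add: inner_axis' augment_def)

lemma residual_inner:
  "residual h b i \<bullet> gtilde x =
     curv h * (b i \<bullet> gtilde x) + lam h * (\<Sum>j\<in>UNIV - {i}. b j \<bullet> gtilde x) - g x $ i + mu h * \<omega>bar h"
  using gbar_pos
  by (simp add: residual_def inner_add_left inner_diff_left inner_sum_left axis_None_inner axis_Some_inner)

lemma estimators_exist: "\<exists>T. \<forall>i. estimator (T i) a i h"
  unfolding estimator_def observed_span_def
  by (intro choice allI, rule projection_matrix_exists[OF linear_form form_sym form_definite])
     (simp_all add: finite_observed)

lemma estimator_fixes:
  assumes "estimator T a i h" "c \<in> observed_span a i h"
  shows "transpose T *v c = c"
proof -
  have "c - transpose T *v c \<in> observed_span a i h"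
    using assms by (intro subspace_diff subspace_observed_span) (auto simp: estimator_def)
  then have "form (c - transpose T *v c) (c - transpose T *v c) = 0"
    using assms(1) by (auto simp: estimator_def)
  then show ?thesis using form_definite by fastforce
qed

lemma rho_lam: "h \<in> {1..H} \<Longrightarrow> 0 \<le> rho h * lam h" "h \<in> {1..H} \<Longrightarrow> rho h * lam h < 1"
  using lam_nonneg[of h] lam_less_curv[of h] curv_pos[of h] by (simp_all add: rho_eq)

text \<open>A solution is sought with each \<open>v i\<close> in the span observed by i, where the
  projection is the identity. The products of projections then collapse, and the system becomes that
  of \<open>coupled_projections_solvable\<close> with factor \<open>rho h * lam h\<close>, which is
  below 1.\<close>

lemma coeff_equations_solvable:
  assumes h: "h \<in> {1..H}" and T: "\<And>i. estimator (T i) a i h"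
  shows "\<exists>v r. coeff_equations T h v r"
proof -
  note [simp del] = transpose_matrix_vector
  let ?l = "rho h * lam h" and ?P = "\<lambda>i. transpose (T i)"
  have "\<exists>v. \<forall>i. v i + ?l *\<^sub>R (?P i *v (\<Sum>j\<in>UNIV - {i}. v j)) = rho h *\<^sub>R axis (Some i) 1"
    by (rule coupled_projections_solvable[where B = form and S = "\<lambda>i. observed_span a i h"])
      (use T in \<open>auto simp: estimator_def linear_form subspace_observed_span form_nonneg rho_lam[OF h]
        intro: form_sym form_definite\<close>)
  then obtain v where v: "\<And>i. v i + ?l *\<^sub>R (?P i *v (\<Sum>j\<in>UNIV - {i}. v j)) = rho h *\<^sub>R axis (Some i) 1"
    by blast
  have fix_v: "?P i *v v i = v i" for i
  \<comment> \<open>The solution lies in the span because the right-hand side does: every consumer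
    observes the own preference.\<close>
  proof (rule estimator_fixes[OF T])
    have "v i = rho h *\<^sub>R axis (Some i) 1 - ?l *\<^sub>R (?P i *v (\<Sum>j\<in>UNIV - {i}. v j))"
      using v[of i] by (simp add: algebra_simps)
    also have "\<dots> \<in> observed_span a i h"
      using T by (intro subspace_diff subspace_scale subspace_observed_span own_preference_observed)
        (auto simp: estimator_def)
    finally show "v i \<in> observed_span a i h" .
  qed
  have "(\<Sum>j\<in>UNIV - {i}. (?P i ** ?P j) *v v j) = ?P i *v (\<Sum>j\<in>UNIV - {i}. v j)" for i
    by (simp only: fix_v linear_sum[OF matrix_vector_mul_linear] matrix_vector_mul_assoc[symmetric])
  then have 1: "?P i *v v i + ?l *\<^sub>R (\<Sum>j\<in>UNIV - {i}. (?P i ** ?P j) *v v j) = rho h *\<^sub>R axis (Some i) 1" for i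
    using v by (simp add: fix_v)
  \<comment> \<open>All intercepts can be taken equal, since their equations are symmetric in the
    consumers; one scalar equation with positive coefficient remains.\<close>
  define m where "m = real (CARD('n) - 1)"
  define r where "r = - rho h * mu h * \<omega>bar h / (1 + ?l * m)"
  have "0 < 1 + ?l * m" using rho_lam(1)[OF h] by (simp add: m_def add_pos_nonneg)
  then have "r * (1 + ?l * m) = - rho h * mu h * \<omega>bar h" by (simp add: r_def)
  then have "r + ?l * (\<Sum>j\<in>UNIV - {i}. r) = - rho h * mu h * \<omega>bar h" for i :: 'n
    by (simp add: m_def algebra_simps)
  with 1 show ?thesis
    unfolding coeff_equations_def by (intro exI[of _ v] exI[of _ "\<lambda>_. r"]) blast
qed

text \<open>Scaled by \<open>curv h\<close>, the equations cancel everything in the residual except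
  \<open>lam h\<close> times the error of projecting the others' actions, and that error is
  orthogonal to all that consumer i observes.\<close>

lemma coeff_equations_first_order:
  assumes h: "h \<in> {1..H}" and T: "\<And>i. estimator (T i) a i h" and vr: "coeff_equations T h v r"
  shows "coeff_first_order a h (\<lambda>i. transpose (T i) *v v i + (r i / gbar) *\<^sub>R axis None 1)"
  unfolding coeff_first_order_def
proof (intro allI conjI ballI)
  note [simp del] = transpose_matrix_vector
  fix i
  let ?P = "\<lambda>i. transpose (T i)" and ?e = "axis None 1 :: real^('n option)"
  let ?b = "\<lambda>i. ?P i *v v i + (r i / gbar) *\<^sub>R ?e"
  show "?b i \<in> observed_span a i h"
    using T by (intro subspace_add subspace_scale subspace_observed_span axis_None_observed)
      (auto simp: estimator_def)
  fix c assume c: "c \<in> observed_span a i h"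
  define w where "w = (\<Sum>j\<in>UNIV - {i}. ?P j *v v j)"
  have curv: "curv h \<noteq> 0" using curv_pos[OF h] by simp
  have "(\<Sum>j\<in>UNIV - {i}. (?P i ** ?P j) *v v j) = ?P i *v w"
    by (simp only: w_def linear_sum[OF matrix_vector_mul_linear] matrix_vector_mul_assoc[symmetric])
  moreover have "?P i *v v i + (rho h * lam h) *\<^sub>R (\<Sum>j\<in>UNIV - {i}. (?P i ** ?P j) *v v j) = rho h *\<^sub>R axis (Some i) 1"
    using vr unfolding coeff_equations_def by blast
  ultimately have "?P i *v v i + (lam h / curv h) *\<^sub>R (?P i *v w) = (1 / curv h) *\<^sub>R axis (Some i) 1"
    by (simp add: rho_eq)
  then have "curv h *\<^sub>R (?P i *v v i + (lam h / curv h) *\<^sub>R (?P i *v w)) = curv h *\<^sub>R ((1 / curv h) *\<^sub>R axis (Some i) 1)"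
    by simp
  then have 1: "curv h *\<^sub>R (?P i *v v i) = axis (Some i) 1 - lam h *\<^sub>R (?P i *v w)"
    using curv by (simp add: scaleR_add_right eq_diff_eq)
  have "r i + lam h / curv h * (\<Sum>j\<in>UNIV - {i}. r j) = - (1 / curv h) * mu h * \<omega>bar h"
    using vr by (simp add: coeff_equations_def rho_eq)
  then have "curv h * (r i + lam h / curv h * (\<Sum>j\<in>UNIV - {i}. r j)) = curv h * (- (1 / curv h) * mu h * \<omega>bar h)"
    by (rule arg_cong)
  then have 2: "curv h * r i + lam h * (\<Sum>j\<in>UNIV - {i}. r j) + mu h * \<omega>bar h = 0"
    using curv by (simp add: distrib_left)
  have "(\<Sum>j\<in>UNIV - {i}. ?b j) = w + ((\<Sum>j\<in>UNIV - {i}. r j) / gbar) *\<^sub>R ?e"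
    by (simp add: w_def sum.distrib scaleR_sum_left sum_divide_distrib)
  then have "residual h ?b i = lam h *\<^sub>R (w - ?P i *v w) +
      ((curv h * r i + lam h * (\<Sum>j\<in>UNIV - {i}. r j) + mu h * \<omega>bar h) / gbar) *\<^sub>R ?e"
    unfolding residual_def
    by (simp add: scaleR_add_right 1 scaleR_diff_right add_divide_distrib scaleR_add_left)
  then have "residual h ?b i = lam h *\<^sub>R (w - ?P i *v w)" by (simp add: 2)
  then show "form (residual h ?b i) c = 0"
    using T c by (simp add: linear_scale[OF linear_form] estimator_def)
qed

lemma coeff_first_order_solvable:
  assumes "h \<in> {1..H}"
  shows "\<exists>b. coeff_first_order a h b"
proof -
  obtain T where T: "\<And>i. estimator (T i) a i h" using estimators_exist by blast
  obtain v r where "coeff_equations T h v r" using coeff_equations_solvable[OF assms T] by blast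
  from coeff_equations_first_order[OF assms T this] show ?thesis by blast
qed

lemma observed_span_cong:
  assumes "\<And>t. 1 \<le> t \<Longrightarrow> t < h \<Longrightarrow> a t = a' t"
  shows "observed_span a i h = observed_span a' i h"
proof -
  have "signal_coeff a i k = signal_coeff a' i k" if "k \<in> observed \<Omega> E i h" for k
    using that assms by (cases \<Omega>) (auto simp: signal_coeff_def)
  then show ?thesis unfolding observed_span_def by (simp cong: image_cong_simp)
qed

text \<open>The condition at a slot involves earlier coefficients only through the observed spans,
  so choices can be made by well-founded recursion. No profile enters, which makes the result a
  common reference for all equilibria.\<close>

lemma coefficients_exist: "\<exists>a. \<forall>h\<in>{1..H}. coeff_first_order a h (a h)"
proof -
  have "\<exists>a. \<forall>h. h \<in> {1..H} \<longrightarrow> coeff_first_order a h (a h)"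
  proof (rule dependent_wf_choice[OF wf_less_than])
    fix a a' :: "nat \<Rightarrow> 'n \<Rightarrow> real^('n option)" and h b
    assume "\<And>t. (t, h) \<in> less_than \<Longrightarrow> a t = a' t"
    then have "observed_span a i h = observed_span a' i h" for i
      by (intro observed_span_cong) simp
    then show "(h \<in> {1..H} \<longrightarrow> coeff_first_order a h b) = (h \<in> {1..H} \<longrightarrow> coeff_first_order a' h b)"
      by (simp add: coeff_first_order_def)
  next
    fix h and a :: "nat \<Rightarrow> 'n \<Rightarrow> real^('n option)"
    show "\<exists>b. h \<in> {1..H} \<longrightarrow> coeff_first_order a h b"
      using coeff_first_order_solvable by blast
  qed
  then show ?thesis by blast
qed

section \<open>Realized actions and estimates as affine functions of the preferences\<close>

definition follows :: "'n profile \<Rightarrow> (nat \<Rightarrow> 'n \<Rightarrow> real^('n option)) \<Rightarrow> nat \<Rightarrow> bool" where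
  "follows s a t \<longleftrightarrow> (\<forall>j. AE x in M. action s j t x = a t j \<bullet> gtilde x)"

lemma linear_signals_info:
  assumes s: "strategy_profile s" "h \<in> {1..H}" and past: "\<And>t. 1 \<le> t \<Longrightarrow> t < h \<Longrightarrow> follows s a t"
  shows "linear_signals M g gbar \<Sigma> (observed \<Omega> E i h) (info_of s i h) (signal_coeff a i)"
proof unfold_locales
  show "finite (observed \<Omega> E i h)" by (rule finite_observed)
  show "info_of s i h \<in> M \<rightarrow>\<^sub>M info_space \<Omega> E i h" by (rule info_of_measurable(2)[OF s])
  fix k assume k: "k \<in> observed \<Omega> E i h"
  have cons: "consumption \<Omega> E s (g x) t j = action s j t x" for t j x
    by (simp add: consumption_eq action_def info_of_def)
  show "AE x in M. info_of s i h x k = signal_coeff a i k \<bullet> gtilde x"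
  proof (cases k)
    case Own_Preference
    then show ?thesis using k by (simp add: info_of_def info_def signal_coeff_def axis_Some_inner)
  next
    case (Consumption_Of j t)
    with k have "1 \<le> t" "t < h" by (cases \<Omega>; auto)+
    then have "AE x in M. action s j t x = a t j \<bullet> gtilde x" using past by (simp add: follows_def)
    then show ?thesis using k Consumption_Of by (simp add: info_of_def info_def signal_coeff_def cons)
  next
    case (Total_Consumption t)
    with k have "1 \<le> t" "t < h" by (cases \<Omega>; auto)+
    then have "AE x in M. \<forall>j\<in>UNIV. action s j t x = a t j \<bullet> gtilde x"
      using past by (intro AE_finite_allI) (auto simp: follows_def)
    then show ?thesis
      by eventually_elim
        (use k Total_Consumption in \<open>simp add: info_of_def info_def signal_coeff_def cons inner_sum_left\<close>)
  qed
qed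

text \<open>The differences between the actions and the affine candidates satisfy the homogeneous
  conditions on events, so \<open>coupled_conditions_trivial\<close> makes them vanish. Linearity of
  the strategies at this slot is a result here, not an assumption.\<close>

lemma action_affine:
  assumes s: "strategy_profile s" "h \<in> {1..H}" and past: "\<And>t. 1 \<le> t \<Longrightarrow> t < h \<Longrightarrow> follows s a t"
    and fo: "\<And>i. first_order s i h" and b: "coeff_first_order a h b"
  shows "AE x in M. action s i h x = b i \<bullet> gtilde x"
proof -
  let ?d = "\<lambda>i x. action s i h x - b i \<bullet> gtilde x"
  have "AE x in M. ?d i x = 0"
  proof (rule coupled_conditions_trivial[where k = "curv h" and l = "lam h"])
    show "0 \<le> lam h" "lam h < curv h" using lam_nonneg lam_less_curv s by auto
    show "subalgebra M (info_algebra s i h)" for i by (rule info_subalgebra(1)[OF s])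
    show "square_integrable M (?d i)" for i
      by (intro square_integrable_diff action_square_integrable[OF s] square_integrable_affine)
    fix i
    interpret L: linear_signals M g gbar \<Sigma> "observed \<Omega> E i h" "info_of s i h" "signal_coeff a i"
      by (rule linear_signals_info[OF s past])
    have span: "L.signal_span = observed_span a i h"
      by (simp add: L.signal_span_def observed_span_def)
    have bi: "b i \<in> L.signal_span" "\<And>c. c \<in> L.signal_span \<Longrightarrow> form (residual h b i) c = 0"
      using b by (auto simp: span coeff_first_order_def)
    obtain f where f: "f \<in> borel_measurable (info_algebra s i h)" "AE x in M. b i \<bullet> gtilde x = f x"
      using L.affine_signal_measurable[OF bi(1)] by blast
    have "s i h \<in> borel_measurable (info_space \<Omega> E i h)"
      using s by (auto simp: strategy_profile_def is_strategy_def)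
    then have "action s i h \<in> borel_measurable (info_algebra s i h)"
      unfolding action_def[abs_def] by (rule measurable_compose[OF info_subalgebra(2)[OF s]])
    then show "\<exists>f\<in>borel_measurable (info_algebra s i h). AE x in M. ?d i x = f x"
      using f by (intro bexI[of _ "\<lambda>x. action s i h x - f x"]) auto
    fix A assume A: "A \<in> sets (info_algebra s i h)"
    then have AM: "A \<in> sets M" using info_subalgebra(1)[OF s] by (auto simp: subalgebra_def)
    let ?R = "\<lambda>x. curv h * action s i h x + lam h * (\<Sum>j\<in>UNIV - {i}. action s j h x) - g x $ i + mu h * \<omega>bar h"
    have "square_integrable M ?R"
      by (intro square_integrable_diff square_integrable_add square_integrable_cmult square_integrable_sum
        square_integrable_const action_square_integrable[OF s] preference_square_integrable)
    then have R: "set_integrable M A ?R"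
      unfolding set_integrable_def by (intro integrable_mult_indicator AM integrable_if_square_integrable)
    have Q: "set_integrable M A (\<lambda>x. residual h b i \<bullet> gtilde x)"
      unfolding set_integrable_def
      by (intro integrable_mult_indicator AM integrable_if_square_integrable square_integrable_affine)
    have "curv h * ?d i x + lam h * (\<Sum>j\<in>UNIV - {i}. ?d j x) = ?R x - residual h b i \<bullet> gtilde x" for x
      unfolding residual_inner by (simp add: sum_subtractf algebra_simps)
    then have "(\<integral>x\<in>A. curv h * ?d i x + lam h * (\<Sum>j\<in>UNIV - {i}. ?d j x) \<partial>M) =
        (\<integral>x\<in>A. ?R x \<partial>M) - (\<integral>x\<in>A. residual h b i \<bullet> gtilde x \<partial>M)"
      using set_integral_diff(2)[OF R Q] by simp
    also have "\<dots> = 0"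
      using fo[of i] A L.set_integral_orthogonal[OF bi(2) A] by (simp add: first_order_def)
    finally show "(\<integral>x\<in>A. curv h * ?d i x + lam h * (\<Sum>j\<in>UNIV - {i}. ?d j x) \<partial>M) = 0" .
  qed
  then show ?thesis by simp
qed

lemma equilibrium_follows:
  assumes eq: "equilibrium s" and a: "\<And>h. h \<in> {1..H} \<Longrightarrow> coeff_first_order a h (a h)"
  shows "h \<in> {1..H} \<Longrightarrow> follows s a h"
proof (induction h rule: less_induct)
  case (less h)
  have sp: "strategy_profile s" using eq unfolding equilibrium_iff by blast
  have past: "follows s a t" if "1 \<le> t" "t < h" for t using less that by auto
  show ?case
    unfolding follows_def
    by (intro allI) (rule action_affine[OF sp less.prems past equilibrium_first_order[OF eq less.prems] a[OF less.prems]])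
qed

text \<open>Coordinate k of the profile has the coefficient vector \<open>axis k 1\<close>, whose
  projection is row k of T.\<close>

lemma estimate_eq:
  assumes s: "strategy_profile s" "h \<in> {1..H}" and past: "\<And>t. 1 \<le> t \<Longrightarrow> t < h \<Longrightarrow> follows s a t"
    and T: "estimator T a i h"
  shows "AE x in M. estimate M (info_space \<Omega> E i h) (info_of s i h) gtilde x = T *v gtilde x"
proof -
  interpret L: linear_signals M g gbar \<Sigma> "observed \<Omega> E i h" "info_of s i h" "signal_coeff a i"
    by (rule linear_signals_info[OF s past])
  have span: "L.signal_span = observed_span a i h"
    by (simp add: L.signal_span_def observed_span_def)
  have "AE x in M. \<forall>k\<in>UNIV. cond_expect M (info_space \<Omega> E i h) (info_of s i h) (\<lambda>x. gtilde x $ k) x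
      = (T *v gtilde x) $ k"
  proof (rule AE_finite_allI)
    fix k
    have "(transpose T *v axis k 1) \<bullet> gtilde x = (T *v gtilde x) $ k" for x
      by (simp add: dot_lmul_matrix inner_axis' transpose_matrix_vector)
    moreover have "axis k 1 \<bullet> gtilde x = gtilde x $ k" for x by (simp add: inner_axis')
    ultimately show "AE x in M. cond_expect M (info_space \<Omega> E i h) (info_of s i h) (\<lambda>x. gtilde x $ k) x
        = (T *v gtilde x) $ k"
      using L.cond_expect_affine[of "transpose T *v axis k 1" "axis k 1"] T
      by (simp add: span estimator_def)
  qed simp
  then show ?thesis
    by eventually_elim (simp add: estimate_def vec_eq_iff)
qed

text \<open>Gives access to \<open>affine_in_signals\<close> before there is a profile that could
  generate the signals.\<close>

lemma linear_signals_exact: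
  "finite K \<Longrightarrow> linear_signals M g gbar \<Sigma> K (\<lambda>x. \<lambda>k\<in>K. c k \<bullet> gtilde x) c"
  by unfold_locales
    (auto intro!: measurable_restrict square_integrable_measurable square_integrable_affine)

section \<open>Existence, uniqueness and linear form of the equilibrium\<close>

lemma equilibrium_exists: "\<exists>s. equilibrium s"
proof -
  obtain a where a: "\<And>h. h \<in> {1..H} \<Longrightarrow> coeff_first_order a h (a h)"
    using coefficients_exist by blast
  define sig where "sig i h y = (\<lambda>k\<in>observed \<Omega> E i h. signal_coeff a i k \<bullet> augment gbar y)" for i h y
  have ex: "\<exists>f. f \<in> borel_measurable (info_space \<Omega> E i h) \<and> (\<forall>y. f (sig i h y) = a h i \<bullet> augment gbar y)"
    if h: "h \<in> {1..H}" for i h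
  proof -
    interpret L: linear_signals M g gbar \<Sigma> "observed \<Omega> E i h"
      "\<lambda>x. \<lambda>k\<in>observed \<Omega> E i h. signal_coeff a i k \<bullet> gtilde x" "signal_coeff a i"
      by (rule linear_signals_exact[OF finite_observed])
    have "a h i \<in> L.signal_span"
      using a[OF h] by (auto simp: L.signal_span_def coeff_first_order_def observed_span_def)
    then show ?thesis using L.affine_in_signals unfolding sig_def by blast
  qed
  \<comment> \<open>Strategies read the prescribed affine action off the idealized signals
    \<open>sig\<close>. Values outside the time zone are arbitrary, as no slot inside it observes
    them.\<close>
  define s where "s i h = (SOME f. f \<in> borel_measurable (info_space \<Omega> E i h) \<and>
      (\<forall>y. f (sig i h y) = a h i \<bullet> augment gbar y))" for i h
  have sm: "s i h \<in> borel_measurable (info_space \<Omega> E i h)"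
    and s_eq: "s i h (sig i h y) = a h i \<bullet> augment gbar y" if "h \<in> {1..H}" for i h y
    using someI_ex[OF ex[OF that, of i]] unfolding s_def by blast+
  \<comment> \<open>This closes the circle: under s the actual information equals \<open>sig\<close>
    at every profile, by induction over the slots.\<close>
  have cons: "consumption \<Omega> E s y h i = a h i \<bullet> augment gbar y" if "h \<in> {1..H}" for h i y
    using that
  proof (induction h arbitrary: i rule: less_induct)
    case (less h)
    have "info \<Omega> E s i h y k = sig i h y k" for k
    proof (cases "k \<in> observed \<Omega> E i h")
      case True
      have past: "consumption \<Omega> E s y t j = a t j \<bullet> augment gbar y" if "1 \<le> t" "t < h" for t j
        using less that by auto
      show ?thesis
      proof (cases k)
        case (Consumption_Of j t)
        with True have "1 \<le> t" "t < h" by (cases \<Omega>; auto)+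
        then show ?thesis using True Consumption_Of by (simp add: info_def sig_def signal_coeff_def past)
      next
        case (Total_Consumption t)
        with True have "1 \<le> t" "t < h" by (cases \<Omega>; auto)+
        then show ?thesis using True Total_Consumption
          by (simp add: info_def sig_def signal_coeff_def past inner_sum_left)
      qed (use True in \<open>simp add: info_def sig_def signal_coeff_def axis_Some_inner\<close>)
    qed (simp add: info_def sig_def)
    then have "info \<Omega> E s i h y = sig i h y" by blast
    then show ?case by (simp add: consumption_eq s_eq[OF less.prems])
  qed
  have act: "action s i h x = a h i \<bullet> gtilde x" if "h \<in> {1..H}" for i h x
    using cons[OF that, of "g x" i] by (simp add: consumption_eq action_def info_of_def)
  have sp: "strategy_profile s"
    unfolding strategy_profile_def is_strategy_def
  proof (intro allI ballI conjI sm)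
    fix i h assume h: "h \<in> {1..H}"
    show "integrable M (\<lambda>x. (s i h (info_of s i h x))\<^sup>2)"
      using square_integrable_affine[of "a h i"] act[OF h, of i] by (simp add: action_def square_integrable_def)
  qed
  have "first_order s i h" if h: "h \<in> {1..H}" for i h
    unfolding first_order_def
  proof
    fix A assume A: "A \<in> sets (info_algebra s i h)"
    have past: "follows s a t" if "1 \<le> t" "t < h" for t
      using act[of t] h that by (simp add: follows_def)
    interpret L: linear_signals M g gbar \<Sigma> "observed \<Omega> E i h" "info_of s i h" "signal_coeff a i"
      by (rule linear_signals_info[OF sp h past])
    have "(\<integral>x\<in>A. residual h (a h) i \<bullet> gtilde x \<partial>M) = 0"
      using a[OF h] by (intro L.set_integral_orthogonal A)
        (auto simp: L.signal_span_def coeff_first_order_def observed_span_def)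
    then show "(\<integral>x\<in>A. curv h * action s i h x + lam h * (\<Sum>j\<in>UNIV - {i}. action s j h x)
        - g x $ i + mu h * \<omega>bar h \<partial>M) = 0"
      by (simp add: residual_inner act[OF h])
  qed
  then show ?thesis using equilibrium_if_first_order[OF sp] by blast
qed

text \<open>Strategies are compared at information that actually arises; elsewhere an equilibrium
  does not constrain them. Both information and action agree almost surely with expressions in the
  common coefficients \<open>a\<close>.\<close>

lemma equilibrium_unique:
  assumes s: "equilibrium s" and s': "equilibrium s'" and h: "h \<in> {1..H}"
  shows "AE x in M. info_of s' i h x = info_of s i h x \<and> s' i h (info_of s i h x) = s i h (info_of s i h x)"
proof -
  obtain a where a: "\<And>h. h \<in> {1..H} \<Longrightarrow> coeff_first_order a h (a h)"
    using coefficients_exist by blast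
  have *: "(AE x in M. info_of s i h x = (\<lambda>k\<in>observed \<Omega> E i h. signal_coeff a i k \<bullet> gtilde x)) \<and>
      (AE x in M. action s i h x = a h i \<bullet> gtilde x)" if s: "equilibrium s" for s
  proof
    have sp: "strategy_profile s" using s unfolding equilibrium_iff by blast
    have "follows s a t" if "1 \<le> t" "t < h" for t
      using equilibrium_follows[OF s a] h that by simp
    then interpret L: linear_signals M g gbar \<Sigma> "observed \<Omega> E i h" "info_of s i h" "signal_coeff a i"
      by (intro linear_signals_info[OF sp h])
    show "AE x in M. info_of s i h x = (\<lambda>k\<in>observed \<Omega> E i h. signal_coeff a i k \<bullet> gtilde x)"
      by (rule L.AE_X)
    show "AE x in M. action s i h x = a h i \<bullet> gtilde x"
      using equilibrium_follows[OF s a h] by (simp add: follows_def)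
  qed
  show ?thesis
    using *[OF s, THEN conjunct1] *[OF s, THEN conjunct2] *[OF s', THEN conjunct1] *[OF s', THEN conjunct2]
    by eventually_elim (simp add: action_def)
qed

text \<open>The transposed estimators may have kernels, so v need not be unique. Any solution of the
  coefficient equations yields coefficients meeting the first-order conditions, and
  \<open>action_affine\<close> identifies the resulting affine function with the equilibrium
  action.\<close>

lemma equilibrium_linear:
  assumes s: "equilibrium s" and h: "h \<in> {1..H}"
  shows "\<exists>T. (\<forall>i. AE x in M. estimate M (info_space \<Omega> E i h) (info_of s i h) gtilde x = T i *v gtilde x) \<and>
    (\<exists>v r. coeff_equations T h v r) \<and>
    (\<forall>v r. coeff_equations T h v r \<longrightarrow> (\<forall>i. AE x in M. s i h (info_of s i h x) =
      v i \<bullet> estimate M (info_space \<Omega> E i h) (info_of s i h) gtilde x + r i))"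
proof -
  obtain a where a: "\<And>h. h \<in> {1..H} \<Longrightarrow> coeff_first_order a h (a h)"
    using coefficients_exist by blast
  obtain T where T: "\<And>i. estimator (T i) a i h" using estimators_exist by blast
  have sp: "strategy_profile s" using s unfolding equilibrium_iff by blast
  have past: "follows s a t" if "1 \<le> t" "t < h" for t
    using equilibrium_follows[OF s a] h that by simp
  have est: "AE x in M. estimate M (info_space \<Omega> E i h) (info_of s i h) gtilde x = T i *v gtilde x" for i
    by (rule estimate_eq[OF sp h past T])
  have "AE x in M. s i h (info_of s i h x) =
      v i \<bullet> estimate M (info_space \<Omega> E i h) (info_of s i h) gtilde x + r i"
    if vr: "coeff_equations T h v r" for v r i
  proof -
    have eq: "(transpose (T i) *v v i + (r i / gbar) *\<^sub>R axis None 1) \<bullet> gtilde x =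
        v i \<bullet> (T i *v gtilde x) + r i" for x
      using gbar_pos by (simp add: inner_add_left axis_None_inner dot_lmul_matrix transpose_matrix_vector)
    have "AE x in M. action s i h x = (transpose (T i) *v v i + (r i / gbar) *\<^sub>R axis None 1) \<bullet> gtilde x"
      by (rule action_affine[OF sp h past equilibrium_first_order[OF s h] coeff_equations_first_order[OF h T vr]])
    then show ?thesis
      using est[of i] unfolding eq by eventually_elim (simp add: action_def)
  qed
  with est coeff_equations_solvable[OF h T] show ?thesis by blast
qed

end

theorem proposition1:
  fixes M :: "'a measure"
    and g :: "'a \<Rightarrow> real^'n::finite"
    and gbar :: real and \<Sigma> :: "real^'n^'n"
    and \<omega> :: "nat \<Rightarrow> 'a \<Rightarrow> real" and \<omega>bar \<gamma> \<alpha> \<kappa> :: "nat \<Rightarrow> real"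
    and E :: "('n \<times> 'n) set" and H :: nat
    and \<Gamma> :: behavior and \<Omega> :: info_model
  defines "N \<equiv> real CARD('n)"
    and "Slots \<equiv> {1..H}"
  defines "equilibrium \<equiv> bayes_nash M g \<omega> \<gamma> \<alpha> \<kappa> \<Gamma> \<Omega> E Slots"
    and "gtilde \<equiv> (\<lambda>x. augment gbar (g x))"
    and "I \<equiv> (\<lambda>s i h x. info \<Omega> E s i h (g x))"
  defines "Est \<equiv> (\<lambda>s i h. estimate M (info_space \<Omega> E i h) (I s i h) gtilde)"
    and "\<rho> \<equiv> (\<lambda>h. coeff_rho \<Gamma> N (\<gamma> h) (\<kappa> h) (\<alpha> h))"
    and "lam \<equiv> (\<lambda>h. coeff_lambda \<Gamma> N (\<gamma> h) (\<kappa> h))"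
    and "mu \<equiv> (\<lambda>h. coeff_mu \<Gamma> N (\<gamma> h) (\<kappa> h))"
  assumes "prob_space M"
    and "gbar > 0"
    and "pos_def_matrix \<Sigma>"
    and "distributed M lborel g (\<lambda>y. ennreal (mvnormal_density (\<chi> i. gbar) \<Sigma> y))"
    and "\<And>h. h \<in> Slots \<Longrightarrow> \<gamma> h > 0 \<and> \<alpha> h > 0 \<and> \<kappa> h > 0"
    and "\<And>h. h \<in> Slots \<Longrightarrow> integrable M (\<omega> h) \<and> integral\<^sup>L M (\<omega> h) = \<omega>bar h"
    and "\<And>h. h \<in> Slots \<Longrightarrow> prob_space.indep_set M
           {\<omega> h -` A \<inter> space M | A. A \<in> sets borel} {g -` B \<inter> space M | B. B \<in> sets borel}"
  shows "(\<exists>s. equilibrium s) \<and>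
    (\<forall>s s'. equilibrium s \<and> equilibrium s' \<longrightarrow>
       (\<forall>i. \<forall>h\<in>Slots. AE x in M. I s' i h x = I s i h x \<and> s' i h (I s i h x) = s i h (I s i h x))) \<and>
    (\<forall>s. equilibrium s \<longrightarrow>
       (\<forall>h\<in>Slots. \<exists>T :: 'n \<Rightarrow> real^('n option)^('n option).
          (\<forall>i. AE x in M. Est s i h x = T i *v gtilde x) \<and>
          (let coeff_equations = (\<lambda>(v :: 'n \<Rightarrow> real^('n option)) (r :: 'n \<Rightarrow> real).
               (\<forall>i. transpose (T i) *v v i
                   + (\<rho> h * lam h) *\<^sub>R (\<Sum>j\<in>UNIV - {i}. (transpose (T i) ** transpose (T j)) *v v j)
                   = \<rho> h *\<^sub>R axis (Some i) 1) \<and>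
               (\<forall>i. r i + \<rho> h * lam h * (\<Sum>j\<in>UNIV - {i}. r j) = - \<rho> h * mu h * \<omega>bar h))
           in (\<exists>v r. coeff_equations v r) \<and>
              (\<forall>v r. coeff_equations v r \<longrightarrow>
                 (\<forall>i. AE x in M. s i h (I s i h x) = v i \<bullet> Est s i h x + r i)))))"
proof -
  interpret prob_space M by fact
  interpret G: consumption_game M g gbar \<Sigma> \<omega> \<omega>bar \<gamma> \<alpha> \<kappa> E H \<Gamma> \<Omega>
    using assms(11-) unfolding Slots_def by unfold_locales auto
  have I: "I s i h = G.info_of s i h" for s i h
    by (simp add: I_def G.info_of_def fun_eq_iff)
  have coeffs: "\<rho> h = G.rho h" "lam h = G.lam h" "mu h = G.mu h" for h
    by (simp_all add: \<rho>_def lam_def mu_def N_def G.rho_def G.lam_def G.mu_def)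
  show ?thesis
    unfolding Let_def coeffs Est_def I equilibrium_def Slots_def gtilde_def G.coeff_equations_def[symmetric]
    using G.equilibrium_exists G.equilibrium_unique G.equilibrium_linear by blast
qed

end
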